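(* For every $\eta>0$ there exist $\nu>0$ and $n_0$ such that if $n>n_0$ then $$|Forb(n,F_5)\setminus Forb(n,F_5,\eta)| < 2^{(1-\nu)\frac{n^3}{27}}.$$
   Context: A $3$-graph on $[n]$ is a set of $3$-element subsets (edges) of $[n]$. Let $F_5$ be the $3$-graph with edges $\{1,2,3\},\{1,2,4\},\{3,4,5\}$. $Forb(n,F_5)$ is the set of labeled $3$-graphs on $[n]$ containing no (not necessarily induced) copy of $F_5$. For a $3$-graph $\mathcal{H}$ and a partition of its vertex set into three parts, an edge is crossing if it has exactly one vertex in each part, and non-crossing otherwise. An optimal partition of $\mathcal{H}$ is a partition of its vertex set into three parts minimizing the number of non-crossing edges, and $D_{\mathcal{H}}$ denotes the number of non-crossing edges in an optimal partition. $Forb(n,F_5,\eta)$ is the set of $\mathcal{H}\in Forb(n,F_5)$ with $D_{\mathcal{H}}\le \eta n^3$. *)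

theory Defs
  imports Complex_Main "HOL-Library.Ramsey"
begin

text \<open>A \<open>3\<close>-graph on a vertex set \<open>V\<close> is identified with its edge set, a subset of
  \<open>[V]\<^bsup>3\<^esup>\<close> (the \<open>3\<close>-element subsets of \<open>V\<close>).\<close>

definition three_graph :: "'a set \<Rightarrow> 'a set set \<Rightarrow> bool" where
  "three_graph V H \<longleftrightarrow> H \<subseteq> [V]\<^bsup>3\<^esup>"

definition F5 :: "nat set set" where
  "F5 = {{1, 2, 3}, {1, 2, 4}, {3, 4, 5}}"

text \<open>A copy of \<open>F\<close> in \<open>H\<close> need not be induced. \<open>F\<close> is taken without isolated vertices, so
  its vertex set is \<open>\<Union>F\<close>.\<close>

definition contains_copy :: "'b set set \<Rightarrow> 'a set set \<Rightarrow> bool" where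
  "contains_copy F H \<longleftrightarrow> (\<exists>f. inj_on f (\<Union>F) \<and> (\<forall>e\<in>F. f ` e \<in> H))"

definition Forb :: "nat \<Rightarrow> nat set set \<Rightarrow> nat set set set" where
  "Forb n F = {H. three_graph {1..n} H \<and> \<not> contains_copy F H}"

text \<open>Partitions into three parts are ordered, and parts may be empty. With an empty part every
  edge is non-crossing, so admitting empty parts does not change the minimum number of
  non-crossing edges when there are at least three vertices.\<close>

definition three_partition :: "'a set \<Rightarrow> 'a set \<times> 'a set \<times> 'a set \<Rightarrow> bool" where
  "three_partition V = (\<lambda>(A, B, C).
     A \<union> B \<union> C = V \<and> A \<inter> B = {} \<and> A \<inter> C = {} \<and> B \<inter> C = {})"

definition crossing :: "'a set \<times> 'a set \<times> 'a set \<Rightarrow> 'a set \<Rightarrow> bool" where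
  "crossing = (\<lambda>(A, B, C) e. card (e \<inter> A) = 1 \<and> card (e \<inter> B) = 1 \<and> card (e \<inter> C) = 1)"

definition noncrossing_edges ::
    "'a set set \<Rightarrow> 'a set \<times> 'a set \<times> 'a set \<Rightarrow> 'a set set" where
  "noncrossing_edges H P = {e \<in> H. \<not> crossing P e}"

definition optimal_partition ::
    "'a set \<Rightarrow> 'a set set \<Rightarrow> 'a set \<times> 'a set \<times> 'a set \<Rightarrow> bool" where
  "optimal_partition V H P \<longleftrightarrow>
     is_arg_min (\<lambda>Q. card (noncrossing_edges H Q)) (three_partition V) P"

text \<open>The value does not depend on the optimal partition that is chosen; see the two lemmas
  below.\<close>

definition D :: "'a set \<Rightarrow> 'a set set \<Rightarrow> nat" where
  "D V H = card (noncrossing_edges H (SOME P. optimal_partition V H P))"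

lemma optimal_partition_exists: "\<exists>P. optimal_partition V H P"
proof -
  have "three_partition V (V, {}, {})"
    by (simp add: three_partition_def)
  then show ?thesis
    unfolding optimal_partition_def is_arg_min_linorder by (rule ex_has_least_nat)
qed

lemma D_eq:
  assumes "optimal_partition V H P"
  shows "D V H = card (noncrossing_edges H P)"
proof -
  have "optimal_partition V H (SOME P. optimal_partition V H P)"
    using assms by (rule someI)
  with assms show ?thesis
    unfolding D_def optimal_partition_def is_arg_min_linorder by (blast intro: order.antisym)
qed

definition Forb_near :: "nat \<Rightarrow> nat set set \<Rightarrow> real \<Rightarrow> nat set set set" where
  "Forb_near n F \<eta> = {H \<in> Forb n F. real (D {1..n} H) \<le> \<eta> * real n ^ 3}"

end

theory Submission
  imports Defs
begin

text \<open>Let \<open>H\<close> be \<open>F\<^sub>5\<close>-free and let \<open>G\<close> be the graph of pairs of codegree at least three in \<open>H\<close>; there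
  are only \<open>2\<^bsup>O(n\<^sup>2)\<^esup>\<close> candidates for \<open>G\<close>, and all but \<open>O(n\<^sup>2)\<close> edges of \<open>H\<close> are triangles of \<open>G\<close>.
  Being \<open>F\<^sub>5\<close>-free forbids two edges \<open>abc\<close>, \<open>abd\<close> with \<open>cd\<close> in \<open>G\<close>, so \<open>H\<close> is essentially an
  independent set in a conflict graph of maximum degree \<open>O(n)\<close> on the triangles of \<open>G\<close>. The
  Kleitman--Winston algorithm with threshold \<open>\<beta>n\<close> covers these independent sets by
  \<open>2\<^bsup>o(n\<^sup>3)\<^esup>\<close> containers, in each of which every edge has at most \<open>\<beta>n\<close> conflicts.

  It remains to show that a container \<open>A\<close> with nearly \<open>n\<^sup>3/27\<close> edges is nearly tripartite. Few
  conflicts mean that the codegrees of the three pairs of an edge sum to at most \<open>(1 + o(1))n\<close>, so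
  by Cauchy--Schwarz \<open>|A| \<le> (1 + o(1))|\<partial>A|n/9\<close>, and that the links of vertices adjacent in the
  shadow \<open>\<partial>A\<close> are almost disjoint (after deleting few pairs). After passing to a vertex set where
  all degrees are at least about \<open>n\<^sup>2/9\<close>, five adjacent vertices would have links of total size \<open>5n\<^sup>2/9\<close>, more
  than there are pairs. So the shadow has no \<open>K\<^sub>5\<close>, hence at most \<open>3n\<^sup>2/8\<close> edges, which is less than
  the \<open>4n\<^sup>2/9\<close> needed for a \<open>K\<^sub>4\<close>. Thus \<open>\<partial>A\<close> is \<open>K\<^sub>4\<close>-free with nearly \<open>n\<^sup>2/3\<close> edges, and Furedi's
  proof of the stability of Turan's theorem gives the tripartition.\<close>

section \<open>Containers for independent sets in graphs\<close>

lemma graph_containers: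
  fixes d :: real and conf :: "'a \<Rightarrow> 'a \<Rightarrow> bool"
  assumes "finite X"
  shows "\<exists>f. (\<forall>S. f S \<subseteq> X \<and> (\<forall>v\<in>f S. card {u \<in> f S. conf v u} \<le> d)) \<and>
    (\<forall>I\<subseteq>X. (\<forall>u\<in>I. \<forall>v\<in>I. \<not> conf u v) \<longrightarrow>
       (\<exists>S\<subseteq>I. card S * d \<le> card X \<and> I \<subseteq> S \<union> f S))"
  using assms
proof (induction X rule: finite_psubset_induct)
  case (psubset X)
  let ?Q = "\<lambda>X f. (\<forall>S. f S \<subseteq> X \<and> (\<forall>v\<in>f S. card {u \<in> f S. conf v u} \<le> d)) \<and>
    (\<forall>I\<subseteq>X. (\<forall>u\<in>I. \<forall>v\<in>I. \<not> conf u v) \<longrightarrow>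
       (\<exists>S\<subseteq>I. card S * d \<le> card X \<and> I \<subseteq> S \<union> f S))"
  show ?case
  proof (cases "\<forall>v\<in>X. card {u \<in> X. conf v u} \<le> d")
    case True
    show ?thesis
      by (rule exI[of _ "\<lambda>_. X"]) (use True in \<open>auto intro!: exI[of _ "{}"]\<close>)
  next
    case False
    then obtain v where v: "v \<in> X" "card {u \<in> X. conf v u} > d" by force
    define X2 where "X2 = X - insert v {u \<in> X. conf v u}"
    have "X - {v} \<subset> X" "X2 \<subset> X" using v by (auto simp: X2_def)
    from psubset.IH[OF this(1)] obtain f1 where "?Q (X - {v}) f1" by (elim exE)
    then have f1: "\<And>S. f1 S \<subseteq> X - {v}" "\<And>S. \<forall>v\<in>f1 S. card {u \<in> f1 S. conf v u} \<le> d"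
        "\<And>I. I \<subseteq> X - {v} \<Longrightarrow> \<forall>u\<in>I. \<forall>v\<in>I. \<not> conf u v \<Longrightarrow>
          \<exists>S\<subseteq>I. card S * d \<le> card (X - {v}) \<and> I \<subseteq> S \<union> f1 S"
      by simp_all
    from psubset.IH[OF \<open>X2 \<subset> X\<close>] obtain f2 where "?Q X2 f2" by (elim exE)
    then have f2: "\<And>S. f2 S \<subseteq> X2" "\<And>S. \<forall>v\<in>f2 S. card {u \<in> f2 S. conf v u} \<le> d"
        "\<And>I. I \<subseteq> X2 \<Longrightarrow> \<forall>u\<in>I. \<forall>v\<in>I. \<not> conf u v \<Longrightarrow>
          \<exists>S\<subseteq>I. card S * d \<le> card X2 \<and> I \<subseteq> S \<union> f2 S"
      by simp_all
    define f where "f S = (if v \<in> S then f2 (S - {v}) else f1 S)" for S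
    have X2: "card X2 + d \<le> card X"
    proof -
      have "card {u \<in> X. conf v u} + card X2 \<le> card X"
        using psubset.hyps
        by (subst card_Un_disjoint[symmetric]) (auto simp: X2_def intro!: card_mono)
      then show ?thesis using v by linarith
    qed
    have indep: "\<exists>S\<subseteq>I. card S * d \<le> card X \<and> I \<subseteq> S \<union> f S"
      if I: "I \<subseteq> X" "\<forall>u\<in>I. \<forall>v\<in>I. \<not> conf u v" for I
    proof (cases "v \<in> I")
      case True
      then have "I - {v} \<subseteq> X2" using I by (auto simp: X2_def)
      with f2(3)[of "I - {v}"] I(2) obtain S where
        S: "S \<subseteq> I - {v}" "card S * d \<le> card X2" "I - {v} \<subseteq> S \<union> f2 S" by blast
      have "finite S" using S(1) I(1) psubset.hyps by (meson finite_Diff finite_subset)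
      moreover have vS: "v \<notin> S" using S(1) by auto
      ultimately have "card (insert v S) * d \<le> card X"
        using S(2) X2 by (simp add: algebra_simps)
      moreover have "insert v S - {v} = S" using vS by auto
      then have "I \<subseteq> insert v S \<union> f (insert v S)" using S(3) by (auto simp: f_def)
      ultimately show ?thesis using S(1) True by (intro exI[of _ "insert v S"]) auto
    next
      case False
      then have "I \<subseteq> X - {v}" using I by auto
      with f1(3)[of I] I(2) obtain S where
        S: "S \<subseteq> I" "card S * d \<le> card (X - {v})" "I \<subseteq> S \<union> f1 S" by blast
      have "card (X - {v}) \<le> card X" using psubset.hyps by (simp add: card_mono)
      then have "card S * d \<le> card X" using S(2) by linarith
      moreover have "v \<notin> S" using S(1) False by auto
      ultimately show ?thesis using S by (intro exI[of _ S]) (auto simp: f_def)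
    qed
    have "f S \<subseteq> X" for S
      using f1(1)[of S] f2(1)[of "S - {v}"] by (auto simp: f_def X2_def)
    moreover have "\<forall>v\<in>f S. card {u \<in> f S. conf v u} \<le> d" for S
      using f1(2)[of S] f2(2)[of "S - {v}"] by (simp add: f_def)
    ultimately show ?thesis
      using indep by (intro exI[of _ f] conjI allI impI) simp_all
  qed
qed

lemma card_bounded_subsets:
  assumes "finite X"
  shows "finite {S. S \<subseteq> X \<and> card S \<le> k} \<and> card {S. S \<subseteq> X \<and> card S \<le> k} \<le> (card X + 1) ^ k"
proof (induction k)
  case 0
  have "{S. S \<subseteq> X \<and> card S \<le> 0} = {{}}"
    using assms by (auto dest: finite_subset)
  then show ?case by simp
next
  case (Suc k)
  let ?F = "\<lambda>k. {S. S \<subseteq> X \<and> card S \<le> k}"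
  let ?g = "\<lambda>(x, S). insert x S"
  have sub: "?F (Suc k) \<subseteq> ?F k \<union> ?g ` (X \<times> ?F k)"
  proof
    fix S assume "S \<in> ?F (Suc k)"
    then have S: "S \<subseteq> X" "card S \<le> Suc k" by auto
    show "S \<in> ?F k \<union> ?g ` (X \<times> ?F k)"
    proof (cases "S = {}")
      case False
      then obtain x where "x \<in> S" by auto
      then have "S = ?g (x, S - {x})" "x \<in> X" "S - {x} \<in> ?F k"
        using S assms by (auto dest: finite_subset)
      then show ?thesis by (intro UnI2) (metis (no_types, lifting) SigmaI image_eqI)
    qed auto
  qed
  have fin: "finite (?F k)" using Suc by simp
  have finU: "finite (?F k \<union> ?g ` (X \<times> ?F k))" using fin assms by simp
  have "card (?F (Suc k)) \<le> card (?F k \<union> ?g ` (X \<times> ?F k))"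
    by (rule card_mono[OF finU sub])
  also have "\<dots> \<le> card (?F k) + card (?g ` (X \<times> ?F k))" by (rule card_Un_le)
  also have "card (?g ` (X \<times> ?F k)) \<le> card X * card (?F k)"
    using card_image_le[of "X \<times> ?F k" ?g] fin assms by (simp add: card_cartesian_product)
  finally have "card (?F (Suc k)) \<le> (card X + 1) * card (?F k)" by simp
  also have "\<dots> \<le> (card X + 1) ^ Suc k"
    using Suc mult_le_mono2[of _ _ "card X + 1"] by (simp only: power_Suc)
  finally show ?case using finite_subset[OF sub finU] by simp
qed

section \<open>Stability for graphs without large cliques\<close>

lemma furedi_stability:
  fixes E :: "('a \<times> 'a) set"
  assumes "finite W" "E \<subseteq> W \<times> W" "sym E" "irrefl E"
    and "\<And>K. K \<subseteq> W \<Longrightarrow> card K = Suc r \<Longrightarrow> \<exists>x\<in>K. \<exists>y\<in>K. x \<noteq> y \<and> (x, y) \<notin> E"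
  shows "\<exists>p :: 'a \<Rightarrow> nat. (\<forall>x\<in>W. p x < r) \<and>
    card E + card {(x, y) \<in> E. p x = p y} \<le> card {(x, y) \<in> W \<times> W. p x \<noteq> p y}"
  using assms
proof (induction r arbitrary: W E)
  case 0
  have "W = {}"
    using "0.prems"(5)[of "{x}" for x] by force
  then show ?case using "0.prems" by auto
next
  case (Suc r)
  define N where "N x = {y. (x, y) \<in> E}" for x
  have NW: "N x \<subseteq> W" for x using Suc.prems by (auto simp: N_def)
  have fN: "finite (N x)" for x using NW Suc.prems finite_subset by blast
  show ?case
  proof (cases "W = {}")
    case True
    then show ?thesis using Suc.prems by auto
  next
    case False
    then have "Max ((\<lambda>x. card (N x)) ` W) \<in> (\<lambda>x. card (N x)) ` W"
      using Suc.prems by (intro Max_in) auto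
    then obtain v where v: "v \<in> W" "Max ((\<lambda>x. card (N x)) ` W) = card (N v)" by auto
    have vmax: "card (N x) \<le> card (N v)" if "x \<in> W" for x
      using v that Suc.prems by (metis (no_types, lifting) Max_ge finite_imageI imageI)
    let ?U = "W - N v"
    let ?F = "E \<inter> N v \<times> N v"
    have "\<exists>x\<in>K. \<exists>y\<in>K. x \<noteq> y \<and> (x, y) \<notin> ?F" if K: "K \<subseteq> N v" "card K = Suc r" for K
    proof -
      have "v \<notin> K" using K Suc.prems by (auto simp: N_def irrefl_def)
      moreover have "finite K" using K fN finite_subset by blast
      ultimately have "card (insert v K) = Suc (Suc r)" using K by simp
      moreover have "insert v K \<subseteq> W" using K NW v by auto
      ultimately obtain x y where xy: "x \<in> insert v K" "y \<in> insert v K" "x \<noteq> y" "(x, y) \<notin> E"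
        using Suc.prems(5) by meson
      have "(v, z) \<in> E" "(z, v) \<in> E" if "z \<in> K" for z
        using K that Suc.prems by (auto simp: N_def sym_def)
      then show ?thesis using xy by blast
    qed
    moreover have "sym ?F" "irrefl ?F"
      using Suc.prems by (auto simp: sym_def irrefl_def)
    ultimately have "\<exists>p :: 'a \<Rightarrow> nat. (\<forall>x\<in>N v. p x < r) \<and>
        card ?F + card {(x, y) \<in> ?F. p x = p y} \<le> card {(x, y) \<in> N v \<times> N v. p x \<noteq> p y}"
      using fN by (intro Suc.IH) auto
    then obtain p :: "'a \<Rightarrow> nat" where p: "\<forall>x\<in>N v. p x < r"
      "card ?F + card {(x, y) \<in> ?F. p x = p y} \<le> card {(x, y) \<in> N v \<times> N v. p x \<noteq> p y}" by blast
    define q where "q x = (if x \<in> N v then p x else r)" for x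
    have p_neq: "p x \<noteq> r" "r \<noteq> p x" if "x \<in> N v" for x using p(1) that by auto
    have fE: "finite E" using Suc.prems by (meson finite_SigmaI finite_subset)
    let ?E1 = "E \<inter> ?U \<times> N v" and ?E2 = "E \<inter> N v \<times> ?U" and ?E3 = "E \<inter> ?U \<times> ?U"
    have E: "E = ?F \<union> (?E1 \<union> (?E2 \<union> ?E3))" using Suc.prems by auto
    have cE: "card E = card ?F + (card ?E1 + (card ?E2 + card ?E3))"
      apply (subst E)
      apply (subst card_Un_disjoint; (use fE in auto)[1])+
      done
    have "{(x, y) \<in> E. q x = q y} = {(x, y) \<in> ?F. p x = p y} \<union> ?E3"
      using Suc.prems(2) by (auto simp: q_def split: if_splits) (metis p_neq)+
    then have cEin: "card {(x, y) \<in> E. q x = q y} = card {(x, y) \<in> ?F. p x = p y} + card ?E3"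
      using fE by (simp only:) (subst card_Un_disjoint; auto elim: finite_subset[rotated])
    have "?E1 \<union> ?E3 = (SIGMA x:?U. N x)" using NW by (auto simp: N_def)
    then have "card ?E1 + card ?E3 = (\<Sum>x\<in>?U. card (N x))"
      using fE fN Suc.prems(1) by (subst card_Un_disjoint[symmetric]) auto
    also have "\<dots> \<le> card ?U * card (N v)"
      using vmax sum_bounded_above[of ?U "\<lambda>x. card (N x)" "card (N v)"] by auto
    finally have c13: "card ?E1 + card ?E3 \<le> card ?U * card (N v)" .
    have "?E2 = prod.swap ` ?E1" using Suc.prems(3) by (force simp: sym_def image_iff)
    then have c2: "card ?E2 = card ?E1" by (simp add: card_image)
    have "{(x, y) \<in> W \<times> W. q x \<noteq> q y} =
        {(x, y) \<in> N v \<times> N v. p x \<noteq> p y} \<union> (?U \<times> N v \<union> N v \<times> ?U)"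
      using p_neq NW[of v] by (auto simp: q_def)
    moreover have "card ({(x, y) \<in> N v \<times> N v. p x \<noteq> p y} \<union> (?U \<times> N v \<union> N v \<times> ?U))
       = card {(x, y) \<in> N v \<times> N v. p x \<noteq> p y} + (card ?U * card (N v) + card (N v) * card ?U)"
    proof -
      have "finite {(x, y) \<in> N v \<times> N v. p x \<noteq> p y}"
        by (rule finite_subset[of _ "N v \<times> N v"]) (use fN in auto)
      then show ?thesis
        using fN[of v] Suc.prems(1)
        by (simp add: card_Un_disjoint card_cartesian_product disjoint_iff)
    qed
    ultimately have "card {(x, y) \<in> W \<times> W. q x \<noteq> q y} =
      card {(x, y) \<in> N v \<times> N v. p x \<noteq> p y} + 2 * (card ?U * card (N v))" by simp
    then have "card E + card {(x, y) \<in> E. q x = q y} \<le> card {(x, y) \<in> W \<times> W. q x \<noteq> q y}"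
      using cE cEin c13 c2 p(2) by linarith
    moreover have "\<forall>x\<in>W. q x < Suc r" using p(1) by (auto simp: q_def less_SucI)
    ultimately show ?thesis by blast
  qed
qed

lemma sum_squared_le_card_mult:
  fixes g :: "'a \<Rightarrow> real"
  assumes "finite I"
  shows "(\<Sum>i\<in>I. g i)\<^sup>2 \<le> card I * (\<Sum>i\<in>I. (g i)\<^sup>2)"
proof -
  define s where "s = (\<Sum>i\<in>I. g i)"
  define k where "k = real (card I)"
  have "0 \<le> (\<Sum>i\<in>I. (k * g i - s)\<^sup>2)" by (intro sum_nonneg) auto
  also have "\<dots> = (\<Sum>i\<in>I. k\<^sup>2 * (g i)\<^sup>2 - 2 * k * s * g i + s\<^sup>2)"
    by (simp add: power2_eq_square algebra_simps)
  also have "\<dots> = k\<^sup>2 * (\<Sum>i\<in>I. (g i)\<^sup>2) - 2 * k * s * s + k * s\<^sup>2"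
    by (simp add: sum.distrib sum_subtractf s_def k_def flip: sum_distrib_left)
  also have "\<dots> = k * (k * (\<Sum>i\<in>I. (g i)\<^sup>2) - s\<^sup>2)"
    by (simp add: power2_eq_square algebra_simps)
  finally have "0 \<le> k * (k * (\<Sum>i\<in>I. (g i)\<^sup>2) - s\<^sup>2)" .
  moreover have "k > 0 \<or> I = {}" using assms by (auto simp: k_def card_gt_0_iff)
  ultimately show ?thesis by (auto simp: zero_le_mult_iff s_def k_def)
qed

lemma card_crossing_pairs:
  fixes p :: "'a \<Rightarrow> nat"
  assumes "finite W" "\<forall>x\<in>W. p x < r" 
  shows "r * real (card {(x, y) \<in> W \<times> W. p x \<noteq> p y}) \<le> (r - 1) * real (card W) ^ 2"
proof -
  let ?P = "\<lambda>i. {x \<in> W. p x = i}"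
  have "W = (\<Union>i<r. ?P i)" using assms by auto
  then have "card W = card (\<Union>i<r. ?P i)" by simp
  also have "\<dots> = (\<Sum>i<r. card (?P i))"
    using assms by (intro card_UN_disjoint) auto
  finally have s1: "real (card W) = (\<Sum>i<r. real (card (?P i)))" by simp
  have "{(x, y) \<in> W \<times> W. p x = p y} = (\<Union>i<r. ?P i \<times> ?P i)" using assms by auto
  then have "card {(x, y) \<in> W \<times> W. p x = p y} = card (\<Union>i<r. ?P i \<times> ?P i)" by simp
  also have "\<dots> = (\<Sum>i<r. card (?P i \<times> ?P i))"
    using assms by (intro card_UN_disjoint) auto
  finally have s2: "real (card {(x, y) \<in> W \<times> W. p x = p y}) = (\<Sum>i<r. real (card (?P i))^2)"
    by (simp add: card_cartesian_product power2_eq_square)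
  have s3: "(\<Sum>i<r. real (card (?P i)))^2 \<le> (\<Sum>i<r. real (card (?P i))^2) * r"
    using sum_squared_le_card_mult[of "{..<r}" "\<lambda>i. real (card (?P i))"] by (simp add: mult.commute)
  have "W \<times> W = {(x, y) \<in> W \<times> W. p x = p y} \<union> {(x, y) \<in> W \<times> W. p x \<noteq> p y}" by auto
  moreover have "card ({(x, y) \<in> W \<times> W. p x = p y} \<union> {(x, y) \<in> W \<times> W. p x \<noteq> p y})
     = card {(x, y) \<in> W \<times> W. p x = p y} + card {(x, y) \<in> W \<times> W. p x \<noteq> p y}"
    by (rule card_Un_disjoint; (rule finite_subset[of _ "W \<times> W"])?) (use assms in auto)
  ultimately have "card W * card W =
     card {(x, y) \<in> W \<times> W. p x = p y} + card {(x, y) \<in> W \<times> W. p x \<noteq> p y}"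
    by (metis card_cartesian_product)
  then have "real (card W) ^ 2 = real (card {(x, y) \<in> W \<times> W. p x = p y})
      + real (card {(x, y) \<in> W \<times> W. p x \<noteq> p y})"
    by (simp flip: of_nat_add of_nat_mult add: power2_eq_square)
  then have "r * real (card {(x, y) \<in> W \<times> W. p x \<noteq> p y}) =
      r * real (card W) ^ 2 - r * real (card {(x, y) \<in> W \<times> W. p x = p y})"
    by (simp add: algebra_simps)
  moreover have "real (card W) ^ 2 \<le> r * real (card {(x, y) \<in> W \<times> W. p x = p y})"
    using s3 unfolding s1[symmetric] s2[symmetric] by (simp add: mult.commute)
  ultimately show ?thesis by (simp add: left_diff_distrib)
qed

section \<open>Links and shadows of triple systems\<close>

definition triples :: "'a set set \<Rightarrow> (('a \<times> 'a) \<times> 'a) set" where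
  "triples A = {((x, y), z). {x, y, z} \<in> A}"

definition shadow :: "'a set set \<Rightarrow> ('a \<times> 'a) set" where
  "shadow A = {(x, y). \<exists>z. {x, y, z} \<in> A}"

definition nbr :: "'a set set \<Rightarrow> 'a \<Rightarrow> 'a \<Rightarrow> 'a set" where
  "nbr A x y = {z. {x, y, z} \<in> A}"

definition link :: "'a set set \<Rightarrow> 'a \<Rightarrow> ('a \<times> 'a) set" where
  "link A x = {(a, b). {x, a, b} \<in> A}"

definition conflict :: "('a \<times> 'a) set \<Rightarrow> 'a set \<Rightarrow> 'a set \<Rightarrow> bool" where
  "conflict G e f \<longleftrightarrow> (\<exists>a b c d. e = {a, b, c} \<and> f = {a, b, d} \<and> (c, d) \<in> G)"

lemma card_3_distinct: "card {x, y, z} = 3 \<Longrightarrow> x \<noteq> y \<and> x \<noteq> z \<and> y \<noteq> z"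
  by (cases "x = y"; cases "x = z"; cases "y = z") (simp_all add: card_insert_if)

lemma three_graphD:
  assumes "A \<subseteq> [V]\<^bsup>3\<^esup>" "{x, y, z} \<in> A"
  shows "x \<noteq> y" "x \<noteq> z" "y \<noteq> z" "x \<in> V" "y \<in> V" "z \<in> V"
proof -
  from assms have "{x, y, z} \<in> [V]\<^bsup>3\<^esup>" by blast
  then have "{x, y, z} \<subseteq> V \<and> finite {x, y, z} \<and> card {x, y, z} = 3"
    unfolding nsets_def mem_Collect_eq .
  then have c: "card {x, y, z} = 3" and V: "{x, y, z} \<subseteq> V"
    by (rule conjunct2[THEN conjunct2], rule conjunct1)
  show "x \<noteq> y" "x \<noteq> z" "y \<noteq> z" using card_3_distinct[OF c] by simp_all
  show "x \<in> V" "y \<in> V" "z \<in> V" using V by simp_all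
qed

lemma three_graphE:
  assumes "A \<subseteq> [V]\<^bsup>3\<^esup>" "e \<in> A"
  obtains x y z where "e = {x, y, z}" "x \<noteq> y" "x \<noteq> z" "y \<noteq> z" "x \<in> V" "y \<in> V" "z \<in> V"
proof -
  have "card e = 3" using assms by (auto simp: nsets_def)
  then obtain x y z where e: "e = {x, y, z}" by (auto simp: card_3_iff)
  then have "{x, y, z} \<in> A" using assms(2) by simp
  from three_graphD[OF assms(1) this] show ?thesis by (rule that[OF e])
qed

lemma triple_rotate: "{y, x, z} = {x, y, z}" "{x, z, y} = {x, y, z}" "{y, z, x} = {x, y, z}"
  "{z, x, y} = {x, y, z}" for x y z
  by blast+

lemma finite_three_graph: "finite V \<Longrightarrow> A \<subseteq> [V]\<^bsup>3\<^esup> \<Longrightarrow> finite A"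
  by (rule finite_subset[OF _ finite_imp_finite_nsets])

lemma triples_subset: "A \<subseteq> [V]\<^bsup>3\<^esup> \<Longrightarrow> triples A \<subseteq> (V \<times> V) \<times> V"
  by (auto simp: triples_def dest: three_graphD(4-6))

lemma shadow_subset: "A \<subseteq> [V]\<^bsup>3\<^esup> \<Longrightarrow> shadow A \<subseteq> V \<times> V"
  by (auto simp: shadow_def dest: three_graphD(4-6))

lemma nbr_subset: "A \<subseteq> [V]\<^bsup>3\<^esup> \<Longrightarrow> nbr A x y \<subseteq> V"
  by (auto simp: nbr_def dest: three_graphD(4-6))

lemma shadowI: "{x, y, z} \<in> A \<Longrightarrow> (x, y) \<in> shadow A"
  by (auto simp: shadow_def)

lemma link_subset: "link A x \<subseteq> shadow A"
proof
  fix p assume "p \<in> link A x"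
  then obtain a b where p: "p = (a, b)" and "{x, a, b} \<in> A" by (auto simp: link_def)
  from this(2) have "{a, b, x} \<in> A" unfolding triple_rotate(3)[of a b x] .
  then show "p \<in> shadow A" unfolding p by (rule shadowI)
qed

lemma link_subset_vertices: "A \<subseteq> [V]\<^bsup>3\<^esup> \<Longrightarrow> link A x \<subseteq> V \<times> V"
  by (rule subset_trans[OF link_subset shadow_subset])

lemma sym_shadow: "sym (shadow A)"
proof (rule symI)
  fix x y assume "(x, y) \<in> shadow A"
  then obtain z where "{x, y, z} \<in> A" unfolding shadow_def by blast
  then have "{y, x, z} \<in> A" unfolding triple_rotate(1)[of y x z] .
  then show "(y, x) \<in> shadow A" by (rule shadowI)
qed

lemma irrefl_shadow:
  assumes "A \<subseteq> [V]\<^bsup>3\<^esup>"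
  shows "irrefl (shadow A)"
proof (rule irreflI, rule notI)
  fix x assume "(x, x) \<in> shadow A"
  then obtain z where "{x, x, z} \<in> A" unfolding shadow_def by blast
  from three_graphD(1)[OF assms this] show False by simp
qed

lemma nbr_commute: "nbr A x y = nbr A y x"
  by (simp add: nbr_def insert_commute)

lemma finite_triples: "finite V \<Longrightarrow> A \<subseteq> [V]\<^bsup>3\<^esup> \<Longrightarrow> finite (triples A)"
  by (rule finite_subset[OF triples_subset]) auto

lemma finite_shadow: "finite V \<Longrightarrow> A \<subseteq> [V]\<^bsup>3\<^esup> \<Longrightarrow> finite (shadow A)"
  by (rule finite_subset[OF shadow_subset]) auto

lemma finite_link: "finite V \<Longrightarrow> A \<subseteq> [V]\<^bsup>3\<^esup> \<Longrightarrow> finite (link A x)"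
  by (rule finite_subset[OF link_subset_vertices]) auto

lemma card_triples_le:
  assumes "finite V" "A \<subseteq> [V]\<^bsup>3\<^esup>"
  shows "card (triples A) \<le> card V ^ 3"
proof -
  have "card (triples A) \<le> card ((V \<times> V) \<times> V)"
    using triples_subset[OF assms(2)] assms(1) by (intro card_mono) auto
  then show ?thesis by (simp add: card_cartesian_product power3_eq_cube)
qed

lemma card_triples:
  assumes "finite V" "A \<subseteq> [V]\<^bsup>3\<^esup>"
  shows "card (triples A) = 6 * card A"
proof -
  let ?T = "\<lambda>e. {((x, y), z). {x, y, z} = e}"
  have six: "card (?T e) = 6 \<and> finite (?T e)" if "e \<in> A" for e
  proof -
    from three_graphE[OF assms(2) that] obtain a b c where
      e: "e = {a, b, c}" and d: "a \<noteq> b" "a \<noteq> c" "b \<noteq> c" .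
    have "?T e = {((a, b), c), ((a, c), b), ((b, a), c), ((b, c), a), ((c, a), b), ((c, b), a)}"
      (is "_ = ?R")
    proof (rule equalityI)
      show "?R \<subseteq> ?T e" using e by (simp add: insert_commute)
      show "?T e \<subseteq> ?R"
      proof
        fix t assume "t \<in> ?T e"
        then obtain x y z where t: "t = ((x, y), z)" and xyz: "e = {x, y, z}" by auto
        have "card e = 3" using e d by simp
        then have "x \<noteq> y" "x \<noteq> z" "y \<noteq> z" using card_3_distinct xyz by metis+
        moreover have "x \<in> {a, b, c}" "y \<in> {a, b, c}" "z \<in> {a, b, c}" using e xyz by blast+
        ultimately show "t \<in> ?R" using t by auto
      qed
    qed
    then show ?thesis using d by simp
  qed
  have "triples A = (\<Union>e\<in>A. ?T e)" by (auto simp: triples_def)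
  then have "card (triples A) = (\<Sum>e\<in>A. card (?T e))"
    using finite_three_graph[OF assms] six by (simp only:) (rule card_UN_disjoint; auto)
  also have "\<dots> = 6 * card A" using six by simp
  finally show ?thesis .
qed

lemma shadow_codegree_bound:
  fixes s :: real
  assumes "finite V" "A \<subseteq> [V]\<^bsup>3\<^esup>" "0 \<le> s"
    and s: "\<And>x y z. {x, y, z} \<in> A \<Longrightarrow>
      real (card (nbr A x y)) + card (nbr A x z) + card (nbr A y z) \<le> s"
  shows "3 * card (triples A) \<le> s * card (shadow A)"
proof -
  define g where "g p = real (card (nbr A (fst p) (snd p)))" for p
  have fin: "finite (triples A)" "finite (shadow A)" "finite (nbr A x y)" for x y
    using assms finite_triples finite_shadow finite_subset[OF nbr_subset] by metis+
  have T: "triples A = Sigma (shadow A) (\<lambda>p. nbr A (fst p) (snd p))"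
    by (auto simp: triples_def shadow_def nbr_def)
  have sumT: "(\<Sum>t\<in>triples A. f (fst t)) = (\<Sum>p\<in>shadow A. g p * f p)" for f :: "_ \<Rightarrow> real"
  proof -
    have "(\<Sum>t\<in>triples A. f (fst t)) = (\<Sum>p\<in>shadow A. \<Sum>z\<in>nbr A (fst p) (snd p). f p)"
      unfolding T using fin by (subst sum.Sigma) (auto simp: case_prod_unfold)
    then show ?thesis by (simp add: g_def)
  qed
  have t: "real (card (triples A)) = (\<Sum>p\<in>shadow A. g p)"
    using sumT[of "\<lambda>_. 1"] by simp
  have sq: "(\<Sum>t\<in>triples A. g (fst t)) = (\<Sum>p\<in>shadow A. (g p)\<^sup>2)"
    using sumT[of g] by (simp add: power2_eq_square)
  have sq2: "(\<Sum>t\<in>triples A. g (fst (fst t), snd t)) = (\<Sum>t\<in>triples A. g (fst t))"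
    by (rule sum.reindex_bij_witness[of _ "\<lambda>((x, y), z). ((x, z), y)" "\<lambda>((x, y), z). ((x, z), y)"])
      (auto simp: triples_def triple_rotate(2))
  have sq3: "(\<Sum>t\<in>triples A. g (snd (fst t), snd t)) = (\<Sum>t\<in>triples A. g (fst t))"
    by (rule sum.reindex_bij_witness[of _ "\<lambda>((y, z), x). ((x, y), z)" "\<lambda>((x, y), z). ((y, z), x)"])
      (auto simp: triples_def triple_rotate(3) triple_rotate(4))
  have "3 * (\<Sum>p\<in>shadow A. (g p)\<^sup>2)
      = (\<Sum>t\<in>triples A. g (fst t) + g (fst (fst t), snd t) + g (snd (fst t), snd t))"
    using sq sq2 sq3 by (simp add: sum.distrib)
  also have "\<dots> \<le> (\<Sum>t\<in>triples A. s)"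
    using s by (intro sum_mono) (auto simp: triples_def g_def)
  finally have le: "3 * (\<Sum>p\<in>shadow A. (g p)\<^sup>2) \<le> s * card (triples A)"
    by (simp add: mult.commute)
  have "(real (card (triples A)))\<^sup>2 \<le> card (shadow A) * (\<Sum>p\<in>shadow A. (g p)\<^sup>2)"
    unfolding t by (rule sum_squared_le_card_mult) (rule fin)
  then have "3 * (real (card (triples A)))\<^sup>2 \<le> card (shadow A) * (s * card (triples A))"
    using mult_left_mono[OF le, of "real (card (shadow A))"] by simp
  then have "real (card (triples A)) * (3 * card (triples A)) \<le>
      real (card (triples A)) * (s * card (shadow A))"
    by (simp add: power2_eq_square algebra_simps)
  then show ?thesis using assms(3) by (cases "triples A = {}") (use fin in \<open>simp_all add: card_gt_0_iff\<close>)
qed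

lemma sum_card_le_almost_disjoint:
  fixes c :: real
  assumes "finite K" "finite E" "\<And>x. x \<in> K \<Longrightarrow> L x \<subseteq> E" "0 \<le> c"
    and c: "\<And>x y. x \<in> K \<Longrightarrow> y \<in> K \<Longrightarrow> x \<noteq> y \<Longrightarrow> card (L x \<inter> L y) \<le> c"
  shows "(\<Sum>x\<in>K. real (card (L x))) \<le> card E + real (card K)^2 * c"
proof -
  have "(\<Sum>x\<in>K. real (card (L x))) \<le> card (\<Union>x\<in>K. L x) + real (card K)^2 * c"
    using assms(1,3) c
  proof (induction K)
    case (insert v K)
    let ?U = "\<Union>x\<in>K. L x"
    have fin: "finite (L v)" "finite ?U"
      using insert.prems(1) insert.hyps assms(2) by (auto intro: finite_subset)
    have "card (L v \<inter> ?U) = card (\<Union>x\<in>K. L v \<inter> L x)" by (simp only: Int_UN_distrib)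
    also have "\<dots> \<le> (\<Sum>x\<in>K. card (L v \<inter> L x))" by (rule card_UN_le[OF insert.hyps(1)])
    finally have "real (card (L v \<inter> ?U)) \<le> (\<Sum>x\<in>K. real (card (L v \<inter> L x)))"
      by (simp flip: of_nat_sum)
    also have "\<dots> \<le> (\<Sum>x\<in>K. c)"
      using insert.prems(2) insert.hyps by (intro sum_mono) auto
    finally have "real (card (L v \<inter> ?U)) \<le> card K * c" by simp
    moreover have "card (L v) + card ?U = card (L v \<union> ?U) + card (L v \<inter> ?U)"
      using fin by (rule card_Un_Int)
    then have "real (card (L v)) + card ?U = card (L v \<union> ?U) + card (L v \<inter> ?U)"
      by (simp only: flip: of_nat_add)
    moreover have "(\<Sum>x\<in>K. real (card (L x))) \<le> card ?U + real (card K)^2 * c"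
      using insert by auto
    moreover have "real (card K)^2 * c + card K * c \<le> real (card (insert v K))^2 * c"
      using insert.hyps assms(4) by (simp add: power2_eq_square algebra_simps)
    ultimately show ?case using insert.hyps by simp
  qed auto
  moreover have "card (\<Union>x\<in>K. L x) \<le> card E"
    using assms by (intro card_mono) auto
  ultimately show ?thesis by linarith
qed

lemma shadow_clique_bound:
  fixes c d :: real
  assumes "finite V" "A \<subseteq> [V]\<^bsup>3\<^esup>" "finite K" "0 \<le> c"
    and d: "\<And>x. x \<in> K \<Longrightarrow> d \<le> card (link A x)"
    and c: "\<And>x y. (x, y) \<in> shadow A \<Longrightarrow> card (link A x \<inter> link A y) \<le> c"
    and clique: "\<And>x y. x \<in> K \<Longrightarrow> y \<in> K \<Longrightarrow> x \<noteq> y \<Longrightarrow> (x, y) \<in> shadow A"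
  shows "card K * d \<le> card (shadow A) + real (card K)^2 * c"
proof -
  have "card K * d = (\<Sum>x\<in>K. d)" by simp
  also have "\<dots> \<le> (\<Sum>x\<in>K. real (card (link A x)))" using d by (intro sum_mono) auto
  also have "\<dots> \<le> card (shadow A) + real (card K)^2 * c"
    using assms finite_shadow[OF assms(1,2)]
    by (intro sum_card_le_almost_disjoint link_subset) auto
  finally show ?thesis .
qed

lemma shadow_stability:
  fixes c d :: real
  assumes "finite W" "A \<subseteq> [W]\<^bsup>3\<^esup>" "0 \<le> c" "c \<le> real (card W)^2 / 10^4" "W \<noteq> {}"
    and d: "\<And>x. x \<in> W \<Longrightarrow> d \<le> card (link A x)" "d \<ge> 21/100 * real (card W)^2"
    and c: "\<And>x y. (x, y) \<in> shadow A \<Longrightarrow> card (link A x \<inter> link A y) \<le> c"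
  shows "\<exists>p. (\<forall>x\<in>W. p x < (3::nat)) \<and>
    3 * (real (card (shadow A)) + card {(x, y) \<in> shadow A. p x = p y}) \<le> 2 * real (card W) ^ 2"
proof -
  let ?E = "shadow A" and ?m = "real (card W)"
  have m: "?m^2 > 0" using assms(1,5) by (simp add: card_gt_0_iff)
  have c4: "10000 * c \<le> ?m^2" and d4: "100 * d \<ge> 21 * ?m^2" using assms(4) d(2) by simp_all
  note E = shadow_subset[OF assms(2)] sym_shadow irrefl_shadow[OF assms(2)]
  have step: "\<exists>p. (\<forall>x\<in>W. p x < r) \<and>
      r * (real (card ?E) + card {(x, y) \<in> ?E. p x = p y}) \<le> (real r - 1) * ?m ^ 2"
    if r: "card ?E + (real r + 1)^2 * c < (real r + 1) * d" for r :: nat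
  proof -
    have "\<exists>x\<in>K. \<exists>y\<in>K. x \<noteq> y \<and> (x, y) \<notin> ?E" if K: "K \<subseteq> W" "card K = Suc r" for K
    proof (rule ccontr)
      assume "\<not> ?thesis"
      then have "card K * d \<le> card ?E + real (card K)^2 * c"
        using K assms finite_subset[OF K(1)] by (intro shadow_clique_bound[OF assms(1,2)]) auto
      then show False using r K(2) by (simp add: add.commute)
    qed
    with furedi_stability[OF assms(1) E] obtain p where p: "\<forall>x\<in>W. p x < r"
      "card ?E + card {(x, y) \<in> ?E. p x = p y} \<le> card {(x, y) \<in> W \<times> W. p x \<noteq> p y}" by blast
    have "real (card ?E) + card {(x, y) \<in> ?E. p x = p y} \<le> card {(x, y) \<in> W \<times> W. p x \<noteq> p y}"
      using p(2) by linarith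
    then have "r * (real (card ?E) + card {(x, y) \<in> ?E. p x = p y}) \<le>
        r * real (card {(x, y) \<in> W \<times> W. p x \<noteq> p y})" by (intro mult_left_mono) auto
    also have "\<dots> \<le> (real r - 1) * ?m ^ 2"
      using card_crossing_pairs[OF assms(1) p(1)] by simp
    finally show ?thesis using p(1) by blast
  qed
  have "card ?E \<le> card (W \<times> W)" using E(1) assms(1) by (intro card_mono) auto
  then have "real (card ?E) \<le> ?m^2"
    by (simp add: card_cartesian_product power2_eq_square flip: of_nat_mult)
  then have "card ?E + 25 * c < 5 * d"
    using c4 d4 m by linarith
  then have "card ?E + (real 4 + 1)^2 * c < (real 4 + 1) * d" by simp
  from step[OF this] obtain p :: "'a \<Rightarrow> nat" where
    "real 4 * (real (card ?E) + card {(x, y) \<in> ?E. p x = p y}) \<le> (real 4 - 1) * ?m ^ 2" by blast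
  then have "4 * real (card ?E) \<le> 3 * ?m^2" by simp
  then have "card ?E + 16 * c < 4 * d"
    using c4 d4 m by linarith
  then have "card ?E + (real 3 + 1)^2 * c < (real 3 + 1) * d" by simp
  from step[OF this] show ?thesis by simp
qed

section \<open>Triple systems with few conflicts\<close>

lemma third_vertex_unique:
  assumes "x \<noteq> w" "y \<noteq> w" "{x, y, w} = {x, y, w'}"
  shows "w = w'"
proof -
  have "w \<in> {x, y, w'}" unfolding assms(3)[symmetric] by simp
  then show ?thesis using assms(1,2) by simp
qed

lemma conflictI: "(c, d) \<in> G \<Longrightarrow> conflict G {a, b, c} {a, b, d}"
  unfolding conflict_def by (rule exI[of _ a], rule exI[of _ b], rule exI[of _ c], rule exI[of _ d]) simp

lemma codegree_overlap:
  assumes "finite V" "A \<subseteq> [V]\<^bsup>3\<^esup>" "shadow A \<subseteq> G" "{x, y, z} \<in> A"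
  shows "card (nbr A x y \<inter> nbr A x z) \<le> card {f \<in> A. conflict G {x, y, z} f}"
proof (rule card_inj_on_le)
  show "inj_on (\<lambda>w. {x, y, w}) (nbr A x y \<inter> nbr A x z)"
  proof (rule inj_onI)
    fix w w' assume w: "w \<in> nbr A x y \<inter> nbr A x z" and eq: "{x, y, w} = {x, y, w'}"
    have "{x, y, w} \<in> A" using w by (simp add: nbr_def)
    from third_vertex_unique[OF three_graphD(2,3)[OF assms(2) this] eq] show "w = w'" .
  qed
  show "(\<lambda>w. {x, y, w}) ` (nbr A x y \<inter> nbr A x z) \<subseteq> {f \<in> A. conflict G {x, y, z} f}"
  proof (rule image_subsetI)
    fix w assume w: "w \<in> nbr A x y \<inter> nbr A x z"
    have "{x, z, w} \<in> A" using w by (simp add: nbr_def)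
    then have "{z, w, x} \<in> A" unfolding triple_rotate(3)[of z w x] .
    then have "(z, w) \<in> G" by (rule subsetD[OF assms(3) shadowI])
    then have "conflict G {x, y, z} {x, y, w}" by (rule conflictI)
    then show "{x, y, w} \<in> {f \<in> A. conflict G {x, y, z} f}" using w by (simp add: nbr_def)
  qed
  show "finite {f \<in> A. conflict G {x, y, z} f}"
    using finite_three_graph[OF assms(1,2)] by simp
qed

lemma card_sum_three_le:
  assumes "finite W" "X \<subseteq> W" "Y \<subseteq> W" "Z \<subseteq> W"
  shows "card X + card Y + card Z \<le> card W + card (X \<inter> Y) + card (X \<inter> Z) + card (Y \<inter> Z)"
proof -
  have fin: "finite X" "finite Y" "finite Z" using assms finite_subset by blast+
  have "card X + card Y = card (X \<union> Y) + card (X \<inter> Y)" by (rule card_Un_Int) (rule fin)+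
  moreover have "card (X \<union> Y) + card Z = card (X \<union> Y \<union> Z) + card ((X \<union> Y) \<inter> Z)"
    by (rule card_Un_Int) (use fin in auto)
  moreover have "(X \<union> Y) \<inter> Z = (X \<inter> Z) \<union> (Y \<inter> Z)" by auto
  moreover have "card ((X \<inter> Z) \<union> (Y \<inter> Z)) \<le> card (X \<inter> Z) + card (Y \<inter> Z)" by (rule card_Un_le)
  moreover have "card (X \<union> Y \<union> Z) \<le> card W" using assms by (intro card_mono) auto
  ultimately show ?thesis by simp
qed

lemma nbr_mono: "A \<subseteq> B \<Longrightarrow> nbr A x y \<subseteq> nbr B x y"
  by (auto simp: nbr_def)

lemma link_mono: "A \<subseteq> B \<Longrightarrow> link A x \<subseteq> link B x"
  by (auto simp: link_def)

lemma shadow_mono: "A \<subseteq> B \<Longrightarrow> shadow A \<subseteq> shadow B"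
  unfolding shadow_def by blast

lemma codegree_sum_le:
  fixes c :: real
  assumes "finite V" "A \<subseteq> [V]\<^bsup>3\<^esup>" "shadow A \<subseteq> G"
    and c: "\<And>e. e \<in> A \<Longrightarrow> card {f \<in> A. conflict G e f} \<le> c"
    and W: "finite W" "A' \<subseteq> A" "A' \<subseteq> [W]\<^bsup>3\<^esup>" "{x, y, z} \<in> A'"
  shows "real (card (nbr A' x y)) + card (nbr A' x z) + card (nbr A' y z) \<le> card W + 3 * c"
proof -
  have ov: "card (nbr A' x y \<inter> nbr A' x z) \<le> c" if "{x, y, z} \<in> A'" for x y z
  proof -
    have A: "{x, y, z} \<in> A" using that by (rule subsetD[OF W(2)])
    have "finite (nbr A x y)" using nbr_subset[OF assms(2)] assms(1) by (rule finite_subset)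
    then have "card (nbr A' x y \<inter> nbr A' x z) \<le> card (nbr A x y \<inter> nbr A x z)"
      using nbr_mono[OF W(2)] by (intro card_mono) auto
    also have "\<dots> \<le> card {f \<in> A. conflict G {x, y, z} f}"
      by (rule codegree_overlap[OF assms(1-3) A])
    finally show ?thesis using c[OF A] by linarith
  qed
  have yx: "{y, x, z} \<in> A'" "{z, x, y} \<in> A'"
    unfolding triple_rotate(1)[of y x z] triple_rotate(4)[of z x y] by (rule W(4))+
  have "card (nbr A' x y \<inter> nbr A' x z) \<le> c" using ov[OF W(4)] .
  moreover have "card (nbr A' x y \<inter> nbr A' y z) \<le> c"
    using ov[OF yx(1)] nbr_commute[of A' y x] by simp
  moreover have "card (nbr A' x z \<inter> nbr A' y z) \<le> c"
    using ov[OF yx(2)] nbr_commute[of A' z] by simp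
  moreover have "card (nbr A' x y) + card (nbr A' x z) + card (nbr A' y z) \<le>
      card W + card (nbr A' x y \<inter> nbr A' x z) + card (nbr A' x y \<inter> nbr A' y z)
        + card (nbr A' x z \<inter> nbr A' y z)"
    by (rule card_sum_three_le[OF W(1) nbr_subset[OF W(3)] nbr_subset[OF W(3)] nbr_subset[OF W(3)]])
  ultimately show ?thesis by linarith
qed

text \<open>Counting conflicts twice: a pair of triples \<open>abc\<close>, \<open>abd\<close> with \<open>cd\<close> in the shadow is a
  conflict, and also an element of the intersection of the links of \<open>c\<close> and \<open>d\<close>.\<close>

lemma card_heavy_pairs_le:
  fixes c s :: real
  assumes "finite V" "A \<subseteq> [V]\<^bsup>3\<^esup>" "shadow A \<subseteq> G"
    and c: "\<And>e. e \<in> A \<Longrightarrow> card {f \<in> A. conflict G e f} \<le> c"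
  shows "card {(x, y) \<in> shadow A. s < card (link A x \<inter> link A y)} * s \<le> card (triples A) * c"
proof -
  let ?I = "\<lambda>p. link A (fst p) \<inter> link A (snd p)"
  let ?B = "{(x, y) \<in> shadow A. s < card (link A x \<inter> link A y)}"
  let ?h = "\<lambda>((x, y), (a, b)). (((a, b), x), y)"
  let ?D = "\<lambda>t. {d. {fst (fst t), snd (fst t), d} \<in> A \<and> (snd t, d) \<in> shadow A}"
  have fin: "finite (triples A)" "finite (shadow A)" "finite (?I p)" for p
    using finite_triples[OF assms(1,2)] finite_shadow[OF assms(1,2)] finite_link[OF assms(1,2)]
    by simp_all
  have finD: "finite (?D t)" for t
    by (rule finite_subset[OF _ assms(1)]) (auto dest: three_graphD(6)[OF assms(2)])
  have D: "card (?D t) \<le> c" if "t \<in> triples A" for t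
  proof -
    obtain a b z where t: "t = ((a, b), z)" by (metis surj_pair)
    have abz: "{a, b, z} \<in> A" using that t by (simp add: triples_def)
    have "card (?D t) \<le> card {f \<in> A. conflict G {a, b, z} f}"
    proof (rule card_inj_on_le)
      show "inj_on (\<lambda>d. {a, b, d}) (?D t)"
      proof (rule inj_onI)
        fix w w' assume w: "w \<in> ?D t" and eq: "{a, b, w} = {a, b, w'}"
        have "{a, b, w} \<in> A" using w t by simp
        from third_vertex_unique[OF three_graphD(2,3)[OF assms(2) this] eq] show "w = w'" .
      qed
      show "(\<lambda>d. {a, b, d}) ` ?D t \<subseteq> {f \<in> A. conflict G {a, b, z} f}"
      proof (rule image_subsetI)
        fix w assume w: "w \<in> ?D t"
        then have "(z, w) \<in> G" using t assms(3) by auto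
        then have "conflict G {a, b, z} {a, b, w}" by (rule conflictI)
        then show "{a, b, w} \<in> {f \<in> A. conflict G {a, b, z} f}" using w t by simp
      qed
      show "finite {f \<in> A. conflict G {a, b, z} f}"
        using finite_three_graph[OF assms(1,2)] by simp
    qed
    then show ?thesis using c[OF abz] by linarith
  qed
  have "card (Sigma (shadow A) ?I) \<le> card (Sigma (triples A) ?D)"
  proof (rule card_inj_on_le)
    show "inj_on ?h (Sigma (shadow A) ?I)"
      by (auto simp: inj_on_def)
    show "?h ` Sigma (shadow A) ?I \<subseteq> Sigma (triples A) ?D"
    proof (rule image_subsetI)
      fix q assume "q \<in> Sigma (shadow A) ?I"
      then obtain x y a b where q: "q = ((x, y), (a, b))" "(x, y) \<in> shadow A"
        "{x, a, b} \<in> A" "{y, a, b} \<in> A" by (auto simp: link_def)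
      have "{a, b, x} \<in> A" "{a, b, y} \<in> A"
        unfolding triple_rotate(3)[of a b x] triple_rotate(3)[of a b y] by (rule q)+
      then show "?h q \<in> Sigma (triples A) ?D"
        using q(2) unfolding q(1) by (simp add: triples_def)
    qed
    show "finite (Sigma (triples A) ?D)" using fin finD by auto
  qed
  then have le: "(\<Sum>p\<in>shadow A. card (?I p)) \<le> (\<Sum>t\<in>triples A. card (?D t))"
    using fin finD by (subst (asm) (1 2) card_SigmaI) auto
  have "card ?B * s = (\<Sum>p\<in>?B. s)" by simp
  also have "\<dots> \<le> (\<Sum>p\<in>?B. real (card (?I p)))" by (intro sum_mono) auto
  also have "\<dots> \<le> (\<Sum>p\<in>shadow A. real (card (?I p)))"
    using fin by (intro sum_mono2) auto
  also have "\<dots> \<le> (\<Sum>t\<in>triples A. real (card (?D t)))"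
    using le by (simp flip: of_nat_sum)
  also have "\<dots> \<le> (\<Sum>t\<in>triples A. c)" using D by (intro sum_mono)
  finally show ?thesis by simp
qed

lemma card_triples_remove_pairs:
  assumes "finite V" "A \<subseteq> [V]\<^bsup>3\<^esup>" "B \<subseteq> shadow A" "sym B"
  shows "card (triples A) \<le> card (triples {e \<in> A. \<forall>x\<in>e. \<forall>y\<in>e. (x, y) \<notin> B}) + 3 * (card B * card V)"
    (is "_ \<le> card (triples ?A') + _")
proof -
  let ?f2 = "\<lambda>((x, z), y). ((x, y), z)" and ?f3 = "\<lambda>((y, z), x). ((x, y), z)"
  have finB: "finite B" using finite_subset[OF assms(3) finite_shadow[OF assms(1,2)]] .
  have irr: "(x, x) \<notin> B" for x
    using irrefl_shadow[OF assms(2)] assms(3) by (auto simp: irrefl_def)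
  have sub: "triples A \<subseteq> triples ?A' \<union> (B \<times> V \<union> (?f2 ` (B \<times> V) \<union> ?f3 ` (B \<times> V)))"
  proof
    fix t assume tA: "t \<in> triples A"
    obtain x y z where t: "t = ((x, y), z)" by (metis surj_pair)
    have xyz: "{x, y, z} \<in> A" using tA t by (simp add: triples_def)
    note V = three_graphD(4-6)[OF assms(2) xyz]
    consider "(x, y) \<in> B" | "(x, z) \<in> B" | "(y, z) \<in> B"
      | "(x, y) \<notin> B" "(x, z) \<notin> B" "(y, z) \<notin> B" by blast
    then show "t \<in> triples ?A' \<union> (B \<times> V \<union> (?f2 ` (B \<times> V) \<union> ?f3 ` (B \<times> V)))"
    proof cases
      case 1 then show ?thesis using t V by simp
    next
      case 2
      have "t = ?f2 ((x, z), y)" by (simp add: t)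
      then show ?thesis using 2 V by blast
    next
      case 3
      have "t = ?f3 ((y, z), x)" by (simp add: t)
      then show ?thesis using 3 V by blast
    next
      case 4
      then have "(y, x) \<notin> B" "(z, x) \<notin> B" "(z, y) \<notin> B" using assms(4) by (meson symD)+
      then have "{x, y, z} \<in> ?A'" using xyz irr 4 by simp
      then show ?thesis using t by (simp add: triples_def)
    qed
  qed
  have "?A' \<subseteq> [V]\<^bsup>3\<^esup>" using assms(2) by auto
  from finite_triples[OF assms(1) this] have finT: "finite (triples ?A')" .
  have "card (triples A) \<le> card (triples ?A' \<union> (B \<times> V \<union> (?f2 ` (B \<times> V) \<union> ?f3 ` (B \<times> V))))"
    using finT finB assms(1) by (intro card_mono sub) auto
  also have "\<dots> \<le> card (triples ?A') + (card (B \<times> V) + (card (?f2 ` (B \<times> V)) + card (?f3 ` (B \<times> V))))"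
    by (meson add_left_mono card_Un_le order_trans)
  also have "\<dots> \<le> card (triples ?A') + (card (B \<times> V) + (card (B \<times> V) + card (B \<times> V)))"
    using finB assms(1) by (intro add_mono card_image_le order_refl) auto
  finally show ?thesis by (simp add: card_cartesian_product)
qed

lemma card_triples_remove_vertex:
  assumes "finite V" "A \<subseteq> [V]\<^bsup>3\<^esup>"
  shows "card (triples A) \<le> card (triples {e \<in> A. v \<notin> e}) + 3 * card (link A v)"
    (is "_ \<le> card (triples ?A') + _")
proof -
  let ?f1 = "\<lambda>(a, b). ((v, a), b)" and ?f2 = "\<lambda>(a, b). ((a, v), b)" and ?f3 = "\<lambda>(a, b). ((a, b), v)"
  let ?L = "link A v"
  have sub: "triples A \<subseteq> triples ?A' \<union> (?f1 ` ?L \<union> (?f2 ` ?L \<union> ?f3 ` ?L))"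
  proof
    fix t assume tA: "t \<in> triples A"
    obtain x y z where t: "t = ((x, y), z)" by (metis surj_pair)
    have xyz: "{x, y, z} \<in> A" using tA t by (simp add: triples_def)
    consider "v = x" | "v = y" | "v = z" | "v \<notin> {x, y, z}" by blast
    then show "t \<in> triples ?A' \<union> (?f1 ` ?L \<union> (?f2 ` ?L \<union> ?f3 ` ?L))"
    proof cases
      case 1
      then have "(y, z) \<in> ?L" "t = ?f1 (y, z)" using xyz t by (simp_all add: link_def)
      then show ?thesis by blast
    next
      case 2
      have "{y, x, z} \<in> A" using xyz unfolding triple_rotate(1)[of y x z] .
      then have "(x, z) \<in> ?L" "t = ?f2 (x, z)" using t 2 by (simp_all add: link_def)
      then show ?thesis by blast
    next
      case 3
      have "{z, x, y} \<in> A" using xyz unfolding triple_rotate(4)[of z x y] .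
      then have "(x, y) \<in> ?L" "t = ?f3 (x, y)" using t 3 by (simp_all add: link_def)
      then show ?thesis by blast
    next
      case 4
      then show ?thesis using xyz t by (simp add: triples_def)
    qed
  qed
  have fin: "finite (triples ?A')" "finite ?L"
    using finite_triples[OF assms(1), of ?A'] finite_link[OF assms] assms(2) by auto
  have "card (triples A) \<le> card (triples ?A' \<union> (?f1 ` ?L \<union> (?f2 ` ?L \<union> ?f3 ` ?L)))"
    using fin by (intro card_mono sub) auto
  also have "\<dots> \<le> card (triples ?A') + (card (?f1 ` ?L) + (card (?f2 ` ?L) + card (?f3 ` ?L)))"
    by (meson add_left_mono card_Un_le order_trans)
  also have "\<dots> \<le> card (triples ?A') + (card ?L + (card ?L + card ?L))"
    using fin by (intro add_mono card_image_le order_refl) auto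
  finally show ?thesis by simp
qed

section \<open>Stability of containers\<close>

lemma crossing_of_labelling:
  fixes q :: "'a \<Rightarrow> nat"
  assumes "e = {x, y, z}" "e \<subseteq> V" "\<And>v. v \<in> V \<Longrightarrow> q v < 3"
    and "q x \<noteq> q y" "q x \<noteq> q z" "q y \<noteq> q z"
  shows "crossing ({v \<in> V. q v = 0}, {v \<in> V. q v = 1}, {v \<in> V. q v = 2}) e"
proof -
  have V: "x \<in> V" "y \<in> V" "z \<in> V" using assms(1,2) by auto
  then have "q x < 3" "q y < 3" "q z < 3" using assms(3) by auto
  then have ex: "\<exists>v\<in>e. q v = i" if "i < 3" for i
    using that assms(1,4-6) by (auto simp: less_Suc_eq numeral_3_eq_3)
  have "card (e \<inter> {v \<in> V. q v = i}) = 1" if "i < 3" for i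
  proof -
    from ex[OF that] obtain v where v: "v \<in> e" "q v = i" by auto
    have uniq: "w = v" if "w \<in> e" "q w = i" for w
      using that v assms(1,4-6) by auto
    have "v \<in> V" using v(1) by (rule subsetD[OF assms(2)])
    have "e \<inter> {v \<in> V. q v = i} = {v}"
    proof (intro equalityI subsetI)
      show "w \<in> {v}" if "w \<in> e \<inter> {v \<in> V. q v = i}" for w using that uniq[of w] by simp
      show "w \<in> e \<inter> {v \<in> V. q v = i}" if "w \<in> {v}" for w using that v \<open>v \<in> V\<close> by simp
    qed
    then show ?thesis by simp
  qed
  from this[of 0] this[of 1] this[of 2] show ?thesis by (simp add: crossing_def)
qed

lemma card_noncrossing_le:
  fixes q :: "'a \<Rightarrow> nat"
  assumes "finite V" "A \<subseteq> [V]\<^bsup>3\<^esup>" "\<And>v. v \<in> V \<Longrightarrow> q v < 3"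
  shows "card (noncrossing_edges A ({v \<in> V. q v = 0}, {v \<in> V. q v = 1}, {v \<in> V. q v = 2}))
    \<le> card {((x, y), z) \<in> triples A. q x = q y}" (is "card ?N \<le> card ?T")
proof -
  have "?N \<subseteq> (\<lambda>((x, y), z). {x, y, z}) ` ?T"
  proof
    fix e assume e: "e \<in> ?N"
    then have eA: "e \<in> A" by (simp add: noncrossing_edges_def)
    from three_graphE[OF assms(2) eA] obtain x y z where xyz: "e = {x, y, z}"
      and V: "x \<in> V" "y \<in> V" "z \<in> V" .
    have "e \<subseteq> V" using xyz V by simp
    have "q x = q y \<or> q x = q z \<or> q y = q z"
    proof (rule ccontr)
      assume "\<not> ?thesis"
      then have "crossing ({v \<in> V. q v = 0}, {v \<in> V. q v = 1}, {v \<in> V. q v = 2}) e"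
        by (intro crossing_of_labelling[OF xyz \<open>e \<subseteq> V\<close> assms(3)]) auto
      then show False using e by (simp add: noncrossing_edges_def)
    qed
    then obtain a b c where abc: "e = {a, b, c}" "q a = q b"
      using xyz triple_rotate(2)[of x z y] triple_rotate(3)[of y z x] by metis
    then have "((a, b), c) \<in> ?T" using eA by (simp add: triples_def)
    then show "e \<in> (\<lambda>((x, y), z). {x, y, z}) ` ?T"
      by (rule image_eqI[rotated]) (simp add: abc)
  qed
  moreover have "finite ?T"
    by (rule finite_subset[OF _ finite_triples[OF assms(1,2)]]) auto
  ultimately show ?thesis by (rule surj_card_le[rotated])
qed

text \<open>Here \<open>n\<close> and \<open>m\<close> are the numbers of vertices before and after passing to the vertex set of
  large minimum degree, \<open>t2\<close> counts ordered edges, and \<open>S\<close> and \<open>I\<close> count ordered shadow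
  pairs and those inside a part.\<close>

lemma stability_arithmetic:
  fixes e k m n S I t2 :: real
  assumes e: "0 < e" "e \<le> 1/100" and k: "k = e^2 / 10^6"
    and m: "0 \<le> m" "m \<le> n" "0 < n" and S: "0 \<le> I" "3 * (S + I) \<le> 2 * m^2"
    and cod: "3 * t2 \<le> (m + 3 * (k^2 * n)) * S"
    and t2: "t2 - 2/9 * (1 - e) * m^3 \<ge> 2/9 * (e - e^2/2) * n^3 - 3 * k * n^3"
  shows "(1 - e) * n \<le> m" "m * I \<le> e * n^3"
proof -
  have k0: "0 \<le> k" "k \<le> e / 10^8" "k^2 \<le> k" 
  proof -
    show "0 \<le> k" unfolding k by simp
    have "e * e \<le> e * (1/100)" using e by (intro mult_left_mono) auto
    then show le: "k \<le> e / 10^8" unfolding k by (simp add: power2_eq_square)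
    then have "k * k \<le> k * 1" using \<open>0 \<le> k\<close> e by (intro mult_left_mono) auto
    then show "k^2 \<le> k" by (simp add: power2_eq_square)
  qed
  have mn: "m^2 \<le> n^2" "m^3 \<le> n^3" "0 \<le> m^3" "0 < n^3"
    using m by (auto intro: power_mono)
  have Sm: "S \<le> 2/3 * m^2" using S by argo
  have "S \<le> n^2" using Sm mn(1) zero_le_power2[of m] by argo
  then have "k^2 * n * S \<le> k^2 * n * n^2"
    using m by (intro mult_left_mono) auto
  then have err: "k^2 * n * S \<le> k^2 * n^3" by (simp add: power2_eq_square power3_eq_cube)
  have mS: "m * S \<le> 2/3 * m^3"
    using mult_left_mono[OF Sm m(1)] by (simp add: power2_eq_square power3_eq_cube)
  have up: "3 * t2 \<le> m * S + 3 * (k^2 * n^3)" using cod err by (simp add: algebra_simps)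
  have kn: "k^2 * n^3 \<le> k * n^3" using k0(3) mn(4) by (intro mult_right_mono) auto
  have "2/9 * (e - e^2/2) * n^3 - 3 * k * n^3 \<le> 2/9 * e * m^3 + k * n^3"
  proof -
    have "2/9 * (1 - e) * m^3 = 2/9 * m^3 - 2/9 * e * m^3" by (simp add: field_simps)
    then show ?thesis using up mS kn t2 by argo
  qed
  then have "e * ((1 - e/2) * n^3) \<le> e * m^3 + 18 * k * n^3"
    by (simp add: algebra_simps power2_eq_square)
  moreover have "18 * k * n^3 \<le> e * (e/2) * n^3"
    unfolding k using mn(4) by (intro mult_right_mono) (auto simp: power2_eq_square)
  ultimately have "e * ((1 - e) * n^3) \<le> e * m^3" by (simp add: algebra_simps)
  then have "(1 - e) * n^3 \<le> m^3" using e by simp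
  also have "m^3 \<le> m * n^2" using mult_left_mono[OF mn(1) m(1)] by (simp add: power2_eq_square power3_eq_cube)
  finally have "n^2 * ((1 - e) * n) \<le> n^2 * m" by (simp add: power2_eq_square power3_eq_cube mult.commute mult.left_commute)
  then show "(1 - e) * n \<le> m" using m(3) by simp
  have "3 * (m * S + m * I) \<le> 2 * m^3"
    using mult_left_mono[OF S(2) m(1)] by (simp add: algebra_simps power2_eq_square power3_eq_cube)
  moreover have "2/9 * (e - e^2/2) * n^3 - 3 * k * n^3 \<ge> 0"
  proof -
    have "e^2 \<le> e" using e by (simp add: power2_eq_square mult_left_le)
    then have "0 \<le> 2/9 * (e - e^2/2) - 3 * k" using k0(2) e by simp
    then have "0 \<le> (2/9 * (e - e^2/2) - 3 * k) * n^3" using mn(4) by (intro mult_nonneg_nonneg) auto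
    then show ?thesis by (simp add: left_diff_distrib)
  qed
  then have "3 * t2 \<ge> 2/3 * (1 - e) * m^3" using t2 by linarith
  then have "2/3 * (1 - e) * m^3 \<le> m * S + 3 * (k * n^3)" using up kn by linarith
  ultimately have "3 * (m * I) \<le> 2 * (e * m^3) + 9 * (k * n^3)" by (simp add: algebra_simps)
  moreover have "e * m^3 \<le> e * n^3" using mn e by simp
  moreover have "k * n^3 \<le> e / 10^8 * n^3" using k0 mn by (intro mult_right_mono) auto
  moreover have "0 \<le> e * n^3" using e mn by simp
  ultimately show "m * I \<le> e * n^3" by simp
qed

lemma container_stability:
  fixes e k :: real
  assumes V: "finite V" "A \<subseteq> [V]\<^bsup>3\<^esup>" and G: "shadow A \<subseteq> G"
    and e: "0 < e" "e \<le> 1/100" and k: "k = e^2 / 10^6" and n: "1000 / e \<le> card V"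
    and conf: "\<And>f. f \<in> A \<Longrightarrow> card {g \<in> A. conflict G f g} \<le> k^2 * card V"
    and large: "(1 - e^2/2) * (real (card V)^3 / 27) \<le> card A"
  shows "\<exists>P. three_partition V P \<and> card (noncrossing_edges A P) \<le> 5 * e * real (card V)^3"
proof -
  define n where "n = real (card V)"
  note n' = n[folded n_def]
  have n0: "n > 0" using n' e divide_pos_pos[of 1000 e] by linarith
  have k0: "k > 0" unfolding k using e by simp
  define B where "B = {(x, y) \<in> shadow A. k * n^2 < card (link A x \<inter> link A y)}"
  define A' where "A' = {f \<in> A. \<forall>x\<in>f. \<forall>y\<in>f. (x, y) \<notin> B}"
  have B: "B \<subseteq> shadow A" "sym B"
    using sym_shadow[of A] by (auto simp: B_def sym_def Int_commute)
  have A': "A' \<subseteq> A" "A' \<subseteq> [V]\<^bsup>3\<^esup>" using V by (auto simp: A'_def)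
  have "card B * (k * n^2) \<le> card (triples A) * (k^2 * n)"
    unfolding B_def by (rule card_heavy_pairs_le[OF V G]) (use conf n_def in simp)
  also have "\<dots> \<le> n^3 * (k^2 * n)"
    using card_triples_le[OF V] n0 unfolding n_def
    by (intro mult_right_mono) (simp_all flip: of_nat_power)
  finally have "(k * n^2) * card B \<le> (k * n^2) * (k * n^2)"
    by (simp add: power2_eq_square power3_eq_cube mult_ac)
  then have cardB: "card B \<le> k * n^2" using k0 n0 by simp
  have "card (triples A) \<le> card (triples A') + 3 * (card B * card V)"
    unfolding A'_def by (rule card_triples_remove_pairs[OF V B])
  then have "real (card (triples A)) \<le> card (triples A') + 3 * (card B * n)"
    unfolding n_def by (simp flip: of_nat_mult of_nat_add)
  moreover have "card B * n \<le> k * n^3"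
    using mult_right_mono[OF cardB, of n] n0 by (simp add: power2_eq_square power3_eq_cube)
  ultimately have T': "real (card (triples A)) \<le> card (triples A') + 3 * k * n^3" by simp
  have "real (card (triples A)) = 6 * real (card A)" by (simp add: card_triples[OF V])
  moreover have "(1 - e^2/2) * (n^3 / 27) \<le> card A" using large by (simp only: n_def)
  moreover have "2/9 * (1 - e^2/2) * n^3 = 6 * ((1 - e^2/2) * (n^3 / 27))" by simp
  ultimately have T'_large: "2/9 * (1 - e^2/2) * n^3 - 3 * k * n^3 \<le> card (triples A')"
    using T' by linarith

  define R where "R W = {f \<in> A'. f \<subseteq> W}" for W
  define \<Phi> where "\<Phi> W = card (triples (R W)) - 2/9 * (1 - e) * real (card W)^3" for W
  have "Max (\<Phi> ` Pow V) \<in> \<Phi> ` Pow V" using V by (intro Max_in) auto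
  then obtain W where W: "W \<subseteq> V" "Max (\<Phi> ` Pow V) = \<Phi> W" by auto
  have Wmax: "\<Phi> U \<le> \<Phi> W" if "U \<subseteq> V" for U
    unfolding W(2)[symmetric] using that V by (intro Max_ge) auto
  define m where "m = real (card W)"
  have fW: "finite W" using W V finite_subset by blast
  have RW: "R W \<subseteq> A'" "R W \<subseteq> A" "R W \<subseteq> [W]\<^bsup>3\<^esup>"
    using A' by (auto simp: R_def nsets_def)
  have mn: "m \<le> n" using W V by (simp add: m_def n_def card_mono)
  have "R V = A'" using A' by (auto simp: R_def nsets_def)
  have PhiV: "2/9 * (e - e^2/2) * n^3 - 3 * k * n^3 \<le> card (triples (R W)) - 2/9 * (1 - e) * m^3"
  proof -
    have "card (triples A') - 2/9 * (1 - e) * n^3 \<le> card (triples (R W)) - 2/9 * (1 - e) * m^3"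
      using Wmax[of V] \<open>R V = A'\<close> by (simp only: \<Phi>_def m_def n_def)
    moreover have "2/9 * (e - e^2/2) * n^3 = 2/9 * (1 - e^2/2) * n^3 - 2/9 * (1 - e) * n^3"
      by (simp add: field_simps)
    ultimately show ?thesis using T'_large by linarith
  qed
  have e2: "e^2 \<le> e / 100" using e by (simp add: power2_eq_square)
  have k6: "1000000 * k = e^2" unfolding k by simp
  have m_lower: "e / 9 * n \<le> m"
  proof -
    have "e / 9 \<le> 2/9 * (e - e^2/2) - 3 * k" using e2 e(1) k6 by argo
    then have "e / 9 * n^3 \<le> (2/9 * (e - e^2/2) - 3 * k) * n^3" using n0 by (intro mult_right_mono) auto
    also have "\<dots> \<le> card (triples (R W)) - 2/9 * (1 - e) * m^3"
      using PhiV by (simp add: algebra_simps)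
    also have "\<dots> \<le> card (triples (R W))" using e by (simp add: m_def)
    also have "\<dots> \<le> m^3"
      using card_triples_le[OF fW RW(3)] unfolding m_def by (simp flip: of_nat_power)
    also have "\<dots> \<le> m * n^2"
    proof -
      have "m^2 \<le> n^2" using mn by (intro power_mono) (simp_all add: m_def)
      from mult_left_mono[OF this, of m] show ?thesis
        by (simp add: m_def power3_eq_cube power2_eq_square)
    qed
    finally have "n^2 * (e / 9 * n) \<le> n^2 * m" by (simp add: power3_eq_cube power2_eq_square mult_ac)
    then show ?thesis using n0 by simp
  qed
  have m100: "m \<ge> 111"
  proof -
    have "1000 \<le> e * n" using n' e by (simp add: field_simps)
    then show ?thesis using m_lower by simp
  qed
  have Wne: "W \<noteq> {}" using m100 by (auto simp: m_def)
  have deg: "2/9 * (1 - e) * (m^2 - m) \<le> card (link (R W) v)" if v: "v \<in> W" for v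
  proof -
    have "R (W - {v}) = {f \<in> R W. v \<notin> f}" by (auto simp: R_def)
    then have "card (triples (R W)) \<le> card (triples (R (W - {v}))) + 3 * card (link (R W) v)"
      using card_triples_remove_vertex[OF fW RW(3), of v] by simp
    then have "real (card (triples (R W))) \<le>
        card (triples (R (W - {v}))) + 3 * real (card (link (R W) v))" by linarith
    moreover have "real (card (W - {v})) = m - 1"
      using v fW Wne by (simp add: m_def of_nat_diff card_gt_0_iff Suc_leI)
    moreover have "\<Phi> (W - {v}) \<le> \<Phi> W" using W by (intro Wmax) auto
    ultimately have "card (triples (R (W - {v}))) - 2/9 * (1 - e) * (m - 1)^3 \<le>
        card (triples (R (W - {v}))) + 3 * real (card (link (R W) v)) - 2/9 * (1 - e) * m^3"
      unfolding \<Phi>_def m_def[symmetric] by simp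
    then have "2/9 * (1 - e) * (m^3 - (m - 1)^3) \<le> 3 * card (link (R W) v)"
      by (simp add: right_diff_distrib)
    moreover have "m^3 - (m - 1)^3 \<ge> 3 * (m^2 - m)"
      by (simp add: power3_eq_cube power2_eq_square algebra_simps)
    then have "2/9 * (1 - e) * (3 * (m^2 - m)) \<le> 2/9 * (1 - e) * (m^3 - (m - 1)^3)"
      using e by (intro mult_left_mono) auto
    moreover have "2/9 * (1 - e) * (3 * (m^2 - m)) = 3 * (2/9 * (1 - e) * (m^2 - m))"
      by (rule mult.left_commute)
    ultimately show ?thesis by linarith
  qed
  have deg_large: "21/100 * m^2 \<le> 2/9 * (1 - e) * (m^2 - m)"
  proof -
    have "m * 111 \<le> m * m" using m100 by (intro mult_left_mono) auto
    then have "110/111 * m^2 \<le> m^2 - m" by (simp add: power2_eq_square)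
    then have "2/9 * (99/100) * (110/111 * m^2) \<le> 2/9 * (1 - e) * (m^2 - m)"
      using e by (intro mult_mono) auto
    moreover have "21/100 * m^2 \<le> 2/9 * (99/100) * (110/111 * m^2)" by simp
    ultimately show ?thesis by linarith
  qed
  have c_small: "k * n^2 \<le> m^2 / 10^4"
  proof -
    have "(e / 9 * n)^2 \<le> m^2" using m_lower e n0 by (intro power_mono) auto
    then have "e^2 * n^2 \<le> 81 * m^2" by (simp add: power_mult_distrib power_divide)
    moreover have "1000000 * (k * n^2) = e^2 * n^2" using k6 by (simp flip: mult.assoc)
    ultimately have "10000 * (k * n^2) \<le> m^2" using zero_le_power2[of m] by linarith
    then show ?thesis by simp
  qed
  have link_small: "card (link (R W) x \<inter> link (R W) y) \<le> k * n^2" if xy: "(x, y) \<in> shadow (R W)" for x y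
  proof -
    obtain z where z: "{x, y, z} \<in> R W" using xy unfolding shadow_def by blast
    then have "{x, y, z} \<in> A'" by (rule subsetD[OF RW(1)])
    then have "(x, y) \<notin> B" by (simp add: A'_def)
    moreover have "(x, y) \<in> shadow A" using xy shadow_mono[OF RW(2)] by blast
    ultimately have "card (link A x \<inter> link A y) \<le> k * n^2" by (simp add: B_def)
    moreover have "card (link (R W) x \<inter> link (R W) y) \<le> card (link A x \<inter> link A y)"
      using link_mono[OF RW(2)] finite_link[OF V] by (intro card_mono) auto
    ultimately show ?thesis by linarith
  qed
  let ?S = "shadow (R W)"
  have "\<exists>p. (\<forall>x\<in>W. p x < (3::nat)) \<and>
    3 * (real (card ?S) + card {(x, y) \<in> ?S. p x = p y}) \<le> 2 * real (card W) ^ 2"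
  proof (rule shadow_stability[OF fW RW(3) _ _ Wne deg _ link_small])
    show "k * n^2 \<le> real (card W)^2 / 10^4" using c_small unfolding m_def .
    show "21/100 * real (card W)^2 \<le> 2/9 * (1 - e) * (m^2 - m)"
      using deg_large unfolding m_def .
  qed (use k0 in simp_all)
  then obtain p :: "_ \<Rightarrow> nat" where p: "\<And>x. x \<in> W \<Longrightarrow> p x < 3"
    "3 * (real (card ?S) + card {(x, y) \<in> ?S. p x = p y}) \<le> 2 * m^2" unfolding m_def by blast
  let ?I = "{(x, y) \<in> ?S. p x = p y}"
  have "3 * card (triples (R W)) \<le> (m + 3 * (k^2 * n)) * card ?S"
  proof (rule shadow_codegree_bound[OF fW RW(3)])
    show "0 \<le> m + 3 * (k^2 * n)" using n0 by (simp add: m_def)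
    show "real (card (nbr (R W) x y)) + card (nbr (R W) x z) + card (nbr (R W) y z) \<le> m + 3 * (k^2 * n)"
      if "{x, y, z} \<in> R W" for x y z
      unfolding m_def by (rule codegree_sum_le[OF V G _ fW RW(2,3) that]) (use conf n_def in simp)
  qed
  then have "3 * real (card (triples (R W))) \<le> (m + 3 * (k^2 * n)) * card ?S" by simp
  note ar = stability_arithmetic[OF e k _ mn n0 _ p(2) this PhiV]
  have Wlarge: "(1 - e) * n \<le> m" and inside: "m * card ?I \<le> e * n^3"
    by (rule ar; simp add: m_def)+

  define q where "q v = (if v \<in> W then p v else 0)" for v
  have q3: "q v < 3" for v using p(1) by (simp add: q_def)
  let ?P = "({v \<in> V. q v = 0}, {v \<in> V. q v = 1}, {v \<in> V. q v = 2})"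
  have "three_partition V ?P"
    using q3 by (auto simp: three_partition_def less_Suc_eq numeral_3_eq_3 numeral_2_eq_2)
  moreover have "card (noncrossing_edges A ?P) \<le> 5 * e * n^3"
  proof -
    let ?D = "triples A - triples A'" and ?U = "V - W"
    have "{((x, y), z) \<in> triples A. q x = q y} \<subseteq>
      ?D \<union> ((?U \<times> V) \<times> V \<union> ((V \<times> ?U) \<times> V \<union> ((V \<times> V) \<times> ?U \<union> ?I \<times> W)))"
    proof
      fix t assume t': "t \<in> {((x, y), z) \<in> triples A. q x = q y}"
      then obtain x y z where t: "t = ((x, y), z)" "q x = q y" and xyz: "{x, y, z} \<in> A"
        by (auto simp: triples_def)
      note xV = three_graphD(4-6)[OF V(2) xyz]
      show "t \<in> ?D \<union> ((?U \<times> V) \<times> V \<union> ((V \<times> ?U) \<times> V \<union> ((V \<times> V) \<times> ?U \<union> ?I \<times> W)))"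
      proof (cases "{x, y, z} \<in> A' \<and> x \<in> W \<and> y \<in> W \<and> z \<in> W")
        case True
        then have "{x, y, z} \<in> R W" by (simp add: R_def)
        then have "(x, y) \<in> ?S" by (rule shadowI)
        then show ?thesis using True t by (simp add: q_def)
      next
        case False
        have "t \<in> triples A" using t' by auto
        then show ?thesis using False t xV by (auto simp: triples_def)
      qed
    qed
    moreover have fin: "finite ?D" "finite ?I"
      using finite_triples[OF V] finite_shadow[OF fW RW(3)]
      by (auto elim: finite_subset[rotated])
    ultimately have "card {((x, y), z) \<in> triples A. q x = q y} \<le>
      card (?D \<union> ((?U \<times> V) \<times> V \<union> ((V \<times> ?U) \<times> V \<union> ((V \<times> V) \<times> ?U \<union> ?I \<times> W))))"
      using V fW by (intro card_mono) auto
    also have "\<dots> \<le> card ?D + (card ((?U \<times> V) \<times> V) + (card ((V \<times> ?U) \<times> V) +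
        (card ((V \<times> V) \<times> ?U) + card (?I \<times> W))))"
      by (meson add_left_mono card_Un_le order_trans)
    finally have "card (noncrossing_edges A ?P) \<le> card ?D + (card ((?U \<times> V) \<times> V) +
        (card ((V \<times> ?U) \<times> V) + (card ((V \<times> V) \<times> ?U) + card (?I \<times> W))))"
      using card_noncrossing_le[OF V, of q, OF q3] by linarith
    then have "real (card (noncrossing_edges A ?P)) \<le> real (card ?D) + (card ((?U \<times> V) \<times> V) +
        (card ((V \<times> ?U) \<times> V) + (card ((V \<times> V) \<times> ?U) + card (?I \<times> W))))"
      by linarith
    also have "\<dots> = card ?D + 3 * (card ?U * n^2) + m * card ?I"
      by (simp add: card_cartesian_product n_def m_def power2_eq_square algebra_simps)
    also have "card ?D = real (card (triples A)) - card (triples A')"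
    proof -
      have "triples A' \<subseteq> triples A" using A' by (auto simp: triples_def)
      then show ?thesis using finite_triples[OF V]
        by (metis card_Diff_subset card_mono finite_subset of_nat_diff)
    qed
    also have "real (card ?U) = n - m"
      using W V fW by (simp add: card_Diff_subset card_mono of_nat_diff n_def m_def)
    also have "real (card (triples A)) - card (triples A') + 3 * ((n - m) * n^2) + m * card ?I \<le>
        3 * k * n^3 + 3 * (e * n * n^2) + e * n^3"
      using T' inside mult_right_mono[of "n - m" "e * n" "n^2"] Wlarge by (simp add: algebra_simps)
    also have "\<dots> = (3 * k + 4 * e) * n^3" by (simp add: algebra_simps power2_eq_square power3_eq_cube)
    also have "\<dots> \<le> 5 * e * n^3"
      using k e2 e n0 by (intro mult_right_mono) auto
    finally show ?thesis .
  qed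
  ultimately show ?thesis unfolding n_def by blast
qed

section \<open>Counting\<close>

definition clique_triples :: "'a set \<Rightarrow> ('a \<times> 'a) set \<Rightarrow> 'a set set" where
  "clique_triples V G = {e \<in> [V]\<^bsup>3\<^esup>. \<forall>x\<in>e. \<forall>y\<in>e. x \<noteq> y \<longrightarrow> (x, y) \<in> G}"

definition codegree_graph :: "'a set set \<Rightarrow> ('a \<times> 'a) set" where
  "codegree_graph H = {(x, y). 3 \<le> card (nbr H x y)}"

lemma shadow_clique_triples:
  assumes "A \<subseteq> clique_triples V G"
  shows "shadow A \<subseteq> G"
proof
  fix p assume "p \<in> shadow A"
  then obtain x y z where p: "p = (x, y)" "{x, y, z} \<in> A" unfolding shadow_def by blast
  have "A \<subseteq> [V]\<^bsup>3\<^esup>" using assms by (auto simp: clique_triples_def)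
  from three_graphD(1)[OF this p(2)] have "x \<noteq> y" .
  moreover have "{x, y, z} \<in> clique_triples V G" using p(2) by (rule subsetD[OF assms])
  ultimately show "p \<in> G" unfolding p(1) clique_triples_def by simp
qed

lemma codegree_graph_subset: "H \<subseteq> [V]\<^bsup>3\<^esup> \<Longrightarrow> codegree_graph H \<subseteq> V \<times> V"
proof
  fix p assume H: "H \<subseteq> [V]\<^bsup>3\<^esup>" and "p \<in> codegree_graph H"
  then obtain x y where p: "p = (x, y)" "3 \<le> card (nbr H x y)"
    by (auto simp: codegree_graph_def)
  then have "nbr H x y \<noteq> {}" by auto
  then obtain z where "{x, y, z} \<in> H" by (auto simp: nbr_def)
  from three_graphD(4,5)[OF H this] show "p \<in> V \<times> V" by (simp add: p)
qed

lemma F5_free_conflict_free: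
  assumes H: "H \<subseteq> [V]\<^bsup>3\<^esup>" "\<not> contains_copy F5 H"
    and uv: "u \<in> H" "v \<in> H"
  shows "\<not> conflict (codegree_graph H) u v"
proof
  assume "conflict (codegree_graph H) u v"
  then obtain a b c d where u: "u = {a, b, c}" and v: "v = {a, b, d}"
    and cd: "3 \<le> card (nbr H c d)"
    unfolding conflict_def codegree_graph_def by blast
  have "\<not> nbr H c d \<subseteq> {a, b}"
  proof
    assume "nbr H c d \<subseteq> {a, b}"
    then have "card (nbr H c d) \<le> card {a, b}" by (intro card_mono) auto
    also have "\<dots> \<le> 2" by (simp add: card_insert_if)
    finally show False using cd by simp
  qed
  then obtain e where e: "e \<in> nbr H c d" "e \<noteq> a" "e \<noteq> b" by blast
  then have cde: "{c, d, e} \<in> H" by (simp add: nbr_def)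
  note D = three_graphD(1-3)[OF H(1) uv(1)[unfolded u]] three_graphD(1-3)[OF H(1) uv(2)[unfolded v]]
    three_graphD(1-3)[OF H(1) cde] e(2,3)
  define f where "f i = (if i = 1 then a else if i = 2 then b else if i = 3 then c
    else if i = 4 then d else e)" for i :: nat
  have f: "f 1 = a" "f 2 = b" "f 3 = c" "f 4 = d" "f 5 = e" by (simp_all add: f_def)
  have "\<Union>F5 = {1, 2, 3, 4, 5}" by (auto simp: F5_def)
  moreover have "inj_on f {1, 2, 3, 4, 5}"
    using D f by simp
  moreover have "\<forall>x\<in>F5. f ` x \<in> H"
    using uv cde f by (simp add: F5_def u v)
  ultimately have "contains_copy F5 H" unfolding contains_copy_def by metis
  with H(2) show False by contradiction
qed

lemma card_outside_clique_triples:
  assumes V: "finite V" and H: "H \<subseteq> [V]\<^bsup>3\<^esup>"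
  shows "card (H - clique_triples V (codegree_graph H)) \<le> 2 * card V ^ 2"
proof -
  let ?G = "codegree_graph H"
  let ?P = "V \<times> V - ?G"
  let ?F = "\<lambda>p. (\<lambda>z. {fst p, snd p, z}) ` nbr H (fst p) (snd p)"
  have fin: "finite (nbr H x y)" for x y using nbr_subset[OF H] V by (rule finite_subset)
  have "H - clique_triples V ?G \<subseteq> (\<Union>p\<in>?P. ?F p)"
  proof
    fix f assume f: "f \<in> H - clique_triples V ?G"
    then have "f \<in> [V]\<^bsup>3\<^esup>" using H by auto
    then obtain x y where xy: "x \<in> f" "y \<in> f" "x \<noteq> y" "(x, y) \<notin> ?G"
      using f by (auto simp: clique_triples_def)
    have fV: "f \<subseteq> V" "card f = 3" "finite f" using \<open>f \<in> [V]\<^bsup>3\<^esup>\<close> by (auto simp: nsets_def)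
    have "card (f - {x, y}) = 1" using xy fV by (simp add: card_Diff_subset)
    then obtain z where "f - {x, y} = {z}" by (auto simp: card_1_singleton_iff)
    then have fz: "f = {x, y, z}" using xy by auto
    then have "z \<in> nbr H x y" using f by (simp add: nbr_def)
    moreover have "(x, y) \<in> ?P" using xy fV by auto
    ultimately show "f \<in> (\<Union>p\<in>?P. ?F p)" using fz by (intro UN_I[of "(x, y)"]) auto
  qed
  then have "card (H - clique_triples V ?G) \<le> card (\<Union>p\<in>?P. ?F p)"
    using V fin by (intro card_mono) auto
  also have "\<dots> \<le> (\<Sum>p\<in>?P. card (?F p))" using V by (intro card_UN_le) auto
  also have "\<dots> \<le> (\<Sum>p\<in>?P. 2)"
  proof (rule sum_mono)
    fix p assume "p \<in> ?P"
    then have "card (nbr H (fst p) (snd p)) \<le> 2" by (auto simp: codegree_graph_def)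
    then show "card (?F p) \<le> 2" using card_image_le[OF fin] by (rule order_trans[rotated])
  qed
  also have "\<dots> = 2 * card ?P" by simp
  also have "card ?P \<le> card (V \<times> V)" using V by (intro card_mono) auto
  finally show ?thesis by (simp add: card_cartesian_product power2_eq_square)
qed

lemma card_nsets_3_le:
  assumes "finite V"
  shows "card ([V]\<^bsup>3\<^esup>) \<le> card V ^ 3"
  using card_triples[OF assms subset_refl] card_triples_le[OF assms subset_refl] by linarith

lemma F5_free_container:
  fixes e k :: real
  assumes e: "0 < e" "e \<le> 1/100" and k: "k = e^2 / 10^6" and n: "1000 / e \<le> real n"
    and cont: "\<And>G S. cont G S \<subseteq> clique_triples {1..n} G"
      "\<And>G S f. f \<in> cont G S \<Longrightarrow> card {g \<in> cont G S. conflict G f g} \<le> k^2 * n"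
      "\<And>G I. I \<subseteq> clique_triples {1..n} G \<Longrightarrow> \<forall>u\<in>I. \<forall>v\<in>I. \<not> conflict G u v \<Longrightarrow>
        \<exists>S\<subseteq>I. card S * (k^2 * n) \<le> card (clique_triples {1..n} G) \<and> I \<subseteq> S \<union> cont G S"
    and H: "H \<in> Forb n F5" and far: "\<not> D {1..n} H \<le> (2 + 1/k^2) * real n^2 + 5 * e * real n^3"
  shows "\<exists>G\<subseteq>{1..n}\<times>{1..n}. \<exists>S\<subseteq>[{1..n}]\<^bsup>3\<^esup>. \<exists>Q\<subseteq>[{1..n}]\<^bsup>3\<^esup>.
    card S \<le> (2 + 1/k^2) * real n^2 \<and> card Q \<le> (2 + 1/k^2) * real n^2 \<and>
    card (cont G S) \<le> (1 - e^2/2) * (real n^3 / 27) \<and> (\<exists>B\<subseteq>cont G S. H = Q \<union> B)"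
proof -
  let ?V = "{1..n}"
  have H': "H \<subseteq> [?V]\<^bsup>3\<^esup>" "\<not> contains_copy F5 H"
    using H by (auto simp: Forb_def three_graph_def)
  have n0: "0 < real n" using n e divide_pos_pos[of 1000 e] by linarith
  have k0: "0 < k" unfolding k using e by simp
  define G where "G = codegree_graph H"
  let ?X = "clique_triples ?V G"
  have "\<forall>u\<in>H \<inter> ?X. \<forall>v\<in>H \<inter> ?X. \<not> conflict G u v"
    using F5_free_conflict_free[OF H'] unfolding G_def by blast
  from cont(3)[OF Int_lower2 this] obtain S where S: "S \<subseteq> H \<inter> ?X"
    "card S * (k^2 * n) \<le> card ?X" "H \<inter> ?X \<subseteq> S \<union> cont G S" by blast
  have Xsub: "?X \<subseteq> [?V]\<^bsup>3\<^esup>" by (auto simp: clique_triples_def)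
  have "card ?X \<le> card ([?V]\<^bsup>3\<^esup>)"
    by (rule card_mono[OF finite_imp_finite_nsets Xsub]) simp
  also have "\<dots> \<le> n^3" using card_nsets_3_le[of ?V] by simp
  finally have "real (card ?X) \<le> real n^3" by (simp flip: of_nat_power)
  then have "(k^2 * n) * card S \<le> (k^2 * n) * (1/k^2 * real n^2)"
    using S(2) k0 by (simp add: power2_eq_square power3_eq_cube mult_ac)
  moreover have "0 < k^2 * n" using k0 n0 by simp
  ultimately have cS: "card S \<le> 1/k^2 * real n^2" by (simp only: mult_le_cancel_left_pos)
  define Q where "Q = (H - ?X) \<union> S"
  have "card (H - ?X) \<le> 2 * n^2"
    using card_outside_clique_triples[of ?V H] H' unfolding G_def by simp
  then have "real (card (H - ?X)) \<le> 2 * real n^2" by (simp flip: of_nat_power)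
  moreover have "card Q \<le> card (H - ?X) + card S" unfolding Q_def by (rule card_Un_le)
  ultimately have cQ: "card Q \<le> (2 + 1/k^2) * real n^2" using cS by (simp add: distrib_right)
  have HQ: "H \<subseteq> Q \<union> cont G S" "Q \<subseteq> H" using S by (auto simp: Q_def)
  have A: "cont G S \<subseteq> [?V]\<^bsup>3\<^esup>" using cont(1) Xsub by (rule subset_trans)
  have "card (cont G S) \<le> (1 - e^2/2) * (real n^3 / 27)"
  proof (rule ccontr)
    assume "\<not> ?thesis"
    then have large: "(1 - e^2/2) * (real (card ?V)^3 / 27) \<le> card (cont G S)" by simp
    have "\<exists>P. three_partition ?V P \<and> card (noncrossing_edges (cont G S) P) \<le> 5 * e * real (card ?V)^3"
      by (rule container_stability[OF _ A shadow_clique_triples[OF cont(1)] e k _ _ large])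
        (use n cont(2) in simp_all)
    then obtain P where P: "three_partition ?V P"
      "card (noncrossing_edges (cont G S) P) \<le> 5 * e * real n^3" by auto
    obtain P0 where P0: "optimal_partition ?V H P0" using optimal_partition_exists by blast
    have "D ?V H \<le> card (noncrossing_edges H P)"
      using P0 P(1) unfolding D_eq[OF P0] optimal_partition_def is_arg_min_linorder by blast
    also have "\<dots> \<le> card (Q \<union> noncrossing_edges (cont G S) P)"
    proof (rule card_mono)
      show "finite (Q \<union> noncrossing_edges (cont G S) P)"
        using finite_three_graph[OF _ A] finite_three_graph[OF _ H'(1)] HQ(2)
        by (auto simp: noncrossing_edges_def intro: finite_subset)
      show "noncrossing_edges H P \<subseteq> Q \<union> noncrossing_edges (cont G S) P"
        using HQ(1) by (auto simp: noncrossing_edges_def)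
    qed
    also have "\<dots> \<le> card Q + card (noncrossing_edges (cont G S) P)" by (rule card_Un_le)
    finally show False using far P(2) cQ by linarith
  qed
  moreover have "G \<subseteq> ?V \<times> ?V" unfolding G_def by (rule codegree_graph_subset[OF H'(1)])
  moreover have "S \<subseteq> [?V]\<^bsup>3\<^esup>" "Q \<subseteq> [?V]\<^bsup>3\<^esup>" using S(1) HQ(2) H'(1) by auto
  moreover have "card S \<le> (2 + 1/k^2) * real n^2" using cS n0 by (simp add: distrib_right add_increasing)
  moreover have "H \<inter> cont G S \<subseteq> cont G S" "H = Q \<union> (H \<inter> cont G S)" using HQ by auto
  ultimately show ?thesis using cQ by meson
qed

lemma card_far_le:
  fixes e k :: real
  assumes e: "0 < e" "e \<le> 1/100" and k: "k = e^2 / 10^6" and n: "1000 / e \<le> real n"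
  shows "card {H \<in> Forb n F5. \<not> D {1..n} H \<le> (2 + 1/k^2) * real n^2 + 5 * e * real n^3}
    \<le> 2 powr (real n^2) * (real n^3 + 1) powr (2 * (2 + 1/k^2) * real n^2)
      * 2 powr ((1 - e^2/2) * (real n^3 / 27))"
proof -
  let ?V = "{1..n}" and ?C = "(2 + 1/k^2) * real n^2" and ?M = "(1 - e^2/2) * (real n^3 / 27)"
  let ?P = "\<lambda>G f. (\<forall>S. f S \<subseteq> clique_triples ?V G \<and>
        (\<forall>v\<in>f S. card {u \<in> f S. conflict G v u} \<le> k^2 * n)) \<and>
      (\<forall>I\<subseteq>clique_triples ?V G. (\<forall>u\<in>I. \<forall>v\<in>I. \<not> conflict G u v) \<longrightarrow>
       (\<exists>S\<subseteq>I. card S * (k^2 * n) \<le> card (clique_triples ?V G) \<and> I \<subseteq> S \<union> f S))"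
  have fV: "finite ([?V]\<^bsup>3\<^esup>)" by (rule finite_imp_finite_nsets) simp
  have "\<exists>f. ?P G f" for G
    by (rule graph_containers) (rule finite_subset[OF _ fV], auto simp: clique_triples_def)
  then have "\<forall>G. \<exists>f. ?P G f" by (rule allI)
  from choice[OF this] obtain cont where "\<forall>G. ?P G (cont G)" by (rule exE)
  then have cont: "\<And>G S. cont G S \<subseteq> clique_triples ?V G"
      "\<And>G S f. f \<in> cont G S \<Longrightarrow> card {g \<in> cont G S. conflict G f g} \<le> k^2 * n"
      "\<And>G I. I \<subseteq> clique_triples ?V G \<Longrightarrow> \<forall>u\<in>I. \<forall>v\<in>I. \<not> conflict G u v \<Longrightarrow>
        \<exists>S\<subseteq>I. card S * (k^2 * n) \<le> card (clique_triples ?V G) \<and> I \<subseteq> S \<union> cont G S"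
    by simp_all
  have C0: "0 \<le> ?C" by simp
  define K where "K = nat \<lfloor>?C\<rfloor>"
  have K: "real K \<le> ?C" unfolding K_def using C0 by linarith
  have leK: "m \<le> K" if "real m \<le> ?C" for m unfolding K_def using that by linarith
  define T where "T = {S. S \<subseteq> [?V]\<^bsup>3\<^esup> \<and> card S \<le> K}"
  have T: "finite T" "card T \<le> (card ([?V]\<^bsup>3\<^esup>) + 1) ^ K"
    using card_bounded_subsets[OF fV, of K] by (simp_all add: T_def)
  have "card T \<le> (n^3 + 1)^K"
    using T(2) card_nsets_3_le[of ?V] power_mono[of "card ([?V]\<^bsup>3\<^esup>) + 1" "n^3 + 1" K] by simp
  then have "real (card T) \<le> real ((n^3 + 1)^K)" by (rule of_nat_mono)
  also have "\<dots> = (real n^3 + 1) powr K" by (simp add: powr_realpow add_pos_nonneg add.commute)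
  also have "\<dots> \<le> (real n^3 + 1) powr ?C" using K by (intro powr_mono) auto
  finally have cT: "real (card T) \<le> (real n^3 + 1) powr ?C" .
  define J where "J = {(G, S, Q) \<in> Pow (?V \<times> ?V) \<times> T \<times> T. card (cont G S) \<le> ?M}"
  let ?F = "\<lambda>(G, S, Q). (\<union>) Q ` Pow (cont G S)"
  have finI: "finite (Pow (?V \<times> ?V) \<times> T \<times> T)" using T by simp
  have Jsub: "J \<subseteq> Pow (?V \<times> ?V) \<times> T \<times> T" by (auto simp: J_def)
  have finC: "finite (cont G S)" for G S
    using cont(1) by (rule finite_subset) (rule finite_subset[OF _ fV], auto simp: clique_triples_def)
  have cF: "real (card (?F j)) \<le> 2 powr ?M" if "j \<in> J" for j
  proof -
    obtain G S Q where j: "j = (G, S, Q)" "card (cont G S) \<le> ?M" using \<open>j \<in> J\<close> by (auto simp: J_def)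
    have "card (?F j) \<le> card (Pow (cont G S))"
      unfolding j(1) using finC by (simp add: card_image_le)
    also have "\<dots> = 2 ^ card (cont G S)" using finC by (rule card_Pow)
    finally have "real (card (?F j)) \<le> 2 ^ card (cont G S)" by (simp flip: of_nat_le_iff)
    also have "\<dots> = 2 powr (card (cont G S))" by (simp add: powr_realpow)
    also have "\<dots> \<le> 2 powr ?M" using j(2) by (intro powr_mono) auto
    finally show ?thesis .
  qed
  let ?Far = "{H \<in> Forb n F5. \<not> D ?V H \<le> ?C + 5 * e * real n^3}"
  have "?Far \<subseteq> (\<Union>j\<in>J. ?F j)"
  proof
    fix H assume "H \<in> ?Far"
    then have "H \<in> Forb n F5" "\<not> D ?V H \<le> ?C + 5 * e * real n^3" by auto
    from F5_free_container[OF e k n cont this] obtain G S Q B where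
      "G \<subseteq> ?V \<times> ?V" "S \<subseteq> [?V]\<^bsup>3\<^esup>" "Q \<subseteq> [?V]\<^bsup>3\<^esup>" "card S \<le> ?C" "card Q \<le> ?C"
      and M: "card (cont G S) \<le> ?M" and B: "B \<subseteq> cont G S" "H = Q \<union> B" by blast
    then have "(G, S, Q) \<in> J" using leK by (auto simp: J_def T_def)
    moreover have "H \<in> ?F (G, S, Q)" using B by auto
    ultimately show "H \<in> (\<Union>j\<in>J. ?F j)" by blast
  qed
  moreover have finJ: "finite J" using Jsub finI by (rule finite_subset)
  ultimately have "card ?Far \<le> card (\<Union>j\<in>J. ?F j)"
    using finC by (intro card_mono) auto
  also have "\<dots> \<le> (\<Sum>j\<in>J. card (?F j))" by (rule card_UN_le[OF finJ])
  finally have "real (card ?Far) \<le> (\<Sum>j\<in>J. real (card (?F j)))" by (simp flip: of_nat_sum)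
  also have "\<dots> \<le> (\<Sum>j\<in>J. 2 powr ?M)" using cF by (rule sum_mono)
  also have "\<dots> = card J * 2 powr ?M" by simp
  also have "\<dots> \<le> (2 powr (real n^2) * (real n^3 + 1) powr (2 * (2 + 1/k^2) * real n^2)) * 2 powr ?M"
  proof (rule mult_right_mono)
    have "card J \<le> card (Pow (?V \<times> ?V) \<times> T \<times> T)" using Jsub finI by (intro card_mono)
    also have "\<dots> = 2 ^ (n^2) * (card T * card T)"
      by (simp add: card_cartesian_product card_Pow power2_eq_square)
    finally have "real (card J) \<le> real (2 ^ (n^2) * (card T * card T))" by (rule of_nat_mono)
    also have "\<dots> = 2 powr (real n^2) * (real (card T) * card T)"
      by (simp flip: powr_realpow)
    also have "\<dots> \<le> 2 powr (real n^2) * ((real n^3 + 1) powr ?C * (real n^3 + 1) powr ?C)"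
      using cT by (intro mult_left_mono mult_mono) auto
    also have "(real n^3 + 1) powr ?C * (real n^3 + 1) powr ?C = (real n^3 + 1) powr (2 * (2 + 1/k^2) * real n^2)"
      by (simp only: mult_2 distrib_right powr_add)
    finally show "card J \<le> 2 powr (real n^2) * (real n^3 + 1) powr (2 * (2 + 1/k^2) * real n^2)" .
  qed simp
  finally show ?thesis .
qed

lemma eventually_real_ge: "eventually (\<lambda>n::nat. c \<le> real n) sequentially"
  using filterlim_real_sequentially by (simp add: filterlim_at_top)

lemma square_le_cube_eventually:
  fixes C \<delta> :: real
  assumes "\<delta> > 0"
  shows "eventually (\<lambda>n::nat. C * real n^2 \<le> \<delta> * real n^3) sequentially"
  using eventually_real_ge[of "C / \<delta>"]
proof eventually_elim
  case (elim n)
  then have "C \<le> \<delta> * real n" using assms by (simp add: field_simps)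
  then have "C * real n^2 \<le> \<delta> * real n * real n^2" by (intro mult_right_mono) auto
  then show ?case by (simp add: power2_eq_square power3_eq_cube)
qed

lemma ln_cube_add_one_le:
  assumes "0 \<le> x"
  shows "ln (x^3 + 1) \<le> 6 * sqrt x"
proof -
  have "x^3 + 1 \<le> (x + 1)^3"
    using assms by (simp add: power3_eq_cube algebra_simps)
  also have "\<dots> \<le> ((1 + sqrt x)^2)^3"
    using assms by (intro power_mono) (simp_all add: power2_sum)
  also have "\<dots> = (1 + sqrt x)^6" by (simp flip: power_mult)
  finally have "x^3 + 1 \<le> (1 + sqrt x)^6" .
  moreover have "0 < x^3 + 1" using zero_le_power[OF assms, of 3] by linarith
  ultimately have "ln (x^3 + 1) \<le> ln ((1 + sqrt x)^6)" by (rule ln_mono)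
  also have "\<dots> = 6 * ln (1 + sqrt x)"
    using assms by (subst ln_realpow) (auto intro: add_pos_nonneg)
  also have "ln (1 + sqrt x) \<le> sqrt x" using assms by (intro ln_add_one_self_le_self) simp
  finally show ?thesis by simp
qed

lemma counting_error_eventually:
  fixes C \<delta> :: real
  assumes "\<delta> > 0" "C > 0"
  shows "eventually (\<lambda>n::nat. real n^2 * ln 2 + 2 * C * real n^2 * ln (real n^3 + 1) <
      \<delta> * (real n^3 / 27) * ln 2) sequentially"
proof -
  define L where "L = ln 2 + 12 * C"
  define c where "c = \<delta> / 27 * ln 2"
  have c: "0 < c" using assms by (simp add: c_def)
  show ?thesis using eventually_real_ge[of "(L / c)^2 + 1"]
  proof eventually_elim
    case (elim n)
    define s where "s = sqrt (real n)"
    have n1: "1 \<le> real n" using elim zero_le_power2[of "L / c"] by linarith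
    then have s: "1 \<le> s" "s * s = real n" by (simp_all add: s_def)
    have "L / c < s" unfolding s_def using elim by (intro real_less_rsqrt) linarith
    then have "L < c * s" using c by (simp add: field_simps)
    have "2 * C * real n^2 * ln (real n^3 + 1) \<le> 2 * C * real n^2 * (6 * s)"
      using assms(2) ln_cube_add_one_le[of "real n"] unfolding s_def
      by (intro mult_left_mono) auto
    moreover have "real n^2 * ln 2 * 1 \<le> real n^2 * ln 2 * s"
      using s(1) by (intro mult_left_mono) auto
    ultimately have "real n^2 * ln 2 + 2 * C * real n^2 * ln (real n^3 + 1) \<le>
        real n^2 * ln 2 * s + 2 * C * real n^2 * (6 * s)" by linarith
    also have "\<dots> = L * (real n^2 * s)" by (simp add: L_def algebra_simps)
    also have "\<dots> < c * s * (real n^2 * s)"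
      using \<open>L < c * s\<close> n1 s(1) by (intro mult_strict_right_mono) auto
    also have "\<dots> = c * (real n^2 * (s * s))" by (simp only: mult_ac)
    also have "\<dots> = \<delta> * (real n^3 / 27) * ln 2"
      unfolding s(2) c_def by (simp add: power2_eq_square power3_eq_cube)
    finally show ?case .
  qed
qed

theorem theorem2:
  fixes \<eta> :: real
  assumes "\<eta> > 0"
  shows "\<exists>\<nu>>0. \<exists>n0::nat. \<forall>n>n0.
    real (card (Forb n F5 - Forb_near n F5 \<eta>)) < 2 powr ((1 - \<nu>) * (real n ^ 3 / 27))"
proof -
  define e where "e = min (1/100) (\<eta>/10)"
  define k where "k = e^2 / 10^6"
  define C where "C = 2 + 1/k^2"
  have e: "0 < e" "e \<le> 1/100" "5 * e \<le> \<eta>/2" using assms by (auto simp: e_def)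
  have C: "C > 0" by (simp add: C_def add_pos_nonneg)
  define \<delta> where "\<delta> = e^2 / 4"
  have \<delta>: "\<delta> > 0" using e by (simp add: \<delta>_def)
  note counting_error_eventually[OF \<delta> C]
  moreover have "eventually (\<lambda>n::nat. 1000 / e \<le> real n) sequentially"
    by (rule eventually_real_ge)
  moreover have "eventually (\<lambda>n::nat. C * real n^2 \<le> \<eta>/2 * real n^3) sequentially"
    using assms by (intro square_le_cube_eventually) simp
  ultimately have "eventually (\<lambda>n. real (card (Forb n F5 - Forb_near n F5 \<eta>))
      < 2 powr ((1 - \<delta>) * (real n ^ 3 / 27))) sequentially"
  proof eventually_elim
    case (elim n)
    let ?Far = "{H \<in> Forb n F5. \<not> D {1..n} H \<le> (2 + 1/k^2) * real n^2 + 5 * e * real n^3}"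
    have "5 * e * real n^3 \<le> \<eta>/2 * real n^3" using e by (intro mult_right_mono) auto
    then have "(2 + 1/k^2) * real n^2 + 5 * e * real n^3 \<le> \<eta> * real n^3"
      using elim(3) unfolding C_def by linarith
    then have "Forb n F5 - Forb_near n F5 \<eta> \<subseteq> ?Far" by (auto simp: Forb_near_def)
    moreover have "finite ?Far"
    proof (rule finite_subset)
      show "?Far \<subseteq> Pow ([{1..n}]\<^bsup>3\<^esup>)" by (auto simp: Forb_def three_graph_def)
      show "finite (Pow ([{1..n}]\<^bsup>3\<^esup>))" by (simp add: finite_imp_finite_nsets)
    qed
    ultimately have "card (Forb n F5 - Forb_near n F5 \<eta>) \<le> card ?Far" by (rule card_mono[rotated])
    then have "real (card (Forb n F5 - Forb_near n F5 \<eta>)) \<le> card ?Far" by simp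
    also have "\<dots> \<le> 2 powr (real n^2) * (real n^3 + 1) powr (2 * (2 + 1/k^2) * real n^2)
      * 2 powr ((1 - e^2/2) * (real n^3 / 27))"
      using card_far_le[OF e(1,2) k_def elim(2)] .
    also have "\<dots> = exp (real n^2 * ln 2 + 2 * C * real n^2 * ln (real n^3 + 1)
        + (1 - e^2/2) * (real n^3 / 27) * ln 2)"
    proof -
      have "real n^3 + 1 \<noteq> 0" using zero_le_power[of "real n" 3] by linarith
      then show ?thesis by (simp add: powr_def exp_add C_def)
    qed
    also have "\<dots> < exp (\<delta> * (real n^3 / 27) * ln 2 + (1 - e^2/2) * (real n^3 / 27) * ln 2)"
      using elim(1) by simp
    also have "\<dots> = 2 powr ((1 - \<delta>) * (real n^3 / 27))"
    proof -
      have "1 - \<delta> = \<delta> + (1 - e^2/2)" by (simp add: \<delta>_def)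
      then show ?thesis by (simp only: powr_def distrib_right) simp
    qed
    finally show ?case .
  qed
  then obtain n0 where "\<forall>n\<ge>n0. real (card (Forb n F5 - Forb_near n F5 \<eta>))
      < 2 powr ((1 - \<delta>) * (real n ^ 3 / 27))" by (auto simp: eventually_sequentially)
  then show ?thesis using \<delta> by (intro exI[of _ \<delta>] conjI exI[of _ n0]) auto
qed

end
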